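(* Let $x$ be a wire variable with dual $\bar x$, and let $G = F,\ (x)\bowtie t$ be an AC typed forest (with cut), where $(x)$ is the expansion with single summand $x$. Then $F[\bar x := t]$ is an AC typed forest (with cut) whose type is a closure of the type of $G$.
   Context: **Formulae.** $A ::= a \mid \bar a \mid \top \mid \bot \mid A\land A \mid A\lor A$ ($a$ a proposition symbol); $\bar A$ is the De Morgan dual of $A$. **Expansion trees.** Wire variables come in dual pairs $x,\bar x$. Expansion trees $t$ and witnesses $w$: $t ::= 1 \mid (w+\dots+w) \mid (t\lor t)\mid (t\lor * )\mid ( *\lor t)$, $w ::= x\mid \bar x\mid t\otimes t$, where $(w_1+\dots+w_n)$ is a nonempty finite formal (unordered) sum, called an expansion. **Types.** A type is a formula or a witness type $[a]$, $[\bar a]$, $A\otimes B$, whose underlying formulae are $a$, $\bar a$, $A\land B$ respectively. Typing: $x:[p]$, $\bar x:[\bar p]$ (a positive wire variable has type $[p]$, a negative one $[\bar p]$, dual wire variables having dual types); $1:\top$; $(t\lor * ):A\lor B$ if $t:A$; $( *\lor t):A\lor B$ if $t:B$; $(t\lor s):A\lor B$ and $t\otimes s:A\otimes B$ if $t:A,s:B$; $(w_1+\dots+w_n)$ has type $p$, $\bar p$, $A\land B$ if all $w_i$ have type $[p]$, $[\bar p]$, $A\otimes B$ respectively. **Cuts.** A cut tree $t\bowtie s$ is an unordered pair of expansion trees $t:A$, $s:\bar A$ with $A\neq\top,\bot$. A typed forest with cut is a finite collection of typed expansion trees, typed witnesses and cut trees in which each wire variable occurs at most once and $x$ occurs iff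 $\bar x$ occurs; its type is the collection of types of its roots that are not cuts. **Substitution.** Here $x$ may be of either polarity, and $t$ is an expansion of the type dual to that of $(x)$. $F[\bar x:=t]$ is $F$ with the occurrence of $\bar x$ replaced by $t$: if $\bar x$ is a summand of an expansion, it is replaced by the summands of $t$ (sums are flattened); if $\bar x$ is a root (of witness type), that root is replaced by $t$. **Closure.** A closure of a forest of types $\Gamma$ is a forest of types $\Gamma'$ together with an injective function $f$ from the roots (members) of $\Gamma'$ to those of $\Gamma$ such that each member $r$ of $\Gamma'$ is either equal to the type $f(r)$ or is the underlying formula of the witness type $f(r)$. **AC-correctness.** View a typed forest with cut as a forest of nodes (subterm occurrences, including occurrences of $*$), where a cut $t\bowtie s$ is a root node with successors $t,s$; $(t\lor * )$ has successors $t$ and $*$; an expansion has its summands as successors; wire variables, $1$ and $*$ are leaves. Its graph has an edge from each node to its predecessor and an edge between $x$ and $\bar x$ for each wire variable. Switched nodes are expansions and nodes $t\lor s$ with neither $t$ nor $s$ equal to $*$; all other nodes are unswitched. A switching chooses one successor of each switched node; its switching graph is obtained from the graph by deleting all edges from the non-chosen successors of switched nodes to those nodes and forgetting directions. The forest is AC (AC-correct) if every switching graph is acyclic. *)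

theory Defs
  imports "HOL-Library.Multiset" "HOL-Library.Uprod"
begin

section \<open>Formulae and types\<close>

datatype 'p form =
    Atom 'p
  | NAtom 'p
  | Truth
  | Falsity
  | Conj "'p form" "'p form"
  | Disj "'p form" "'p form"

primrec dual :: "'p form \<Rightarrow> 'p form" where
  "dual (Atom a) = NAtom a"
| "dual (NAtom a) = Atom a"
| "dual Truth = Falsity"
| "dual Falsity = Truth"
| "dual (Conj A B) = Disj (dual A) (dual B)"
| "dual (Disj A B) = Conj (dual A) (dual B)"

datatype 'p wit_type =
    WAtom 'p
  | WNAtom 'p
  | WTensor "'p form" "'p form"

primrec underlying :: "'p wit_type \<Rightarrow> 'p form" where
  "underlying (WAtom a) = Atom a"
| "underlying (WNAtom a) = NAtom a"
| "underlying (WTensor A B) = Conj A B"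

datatype 'p type = Formula "'p form" | Witness "'p wit_type"


section \<open>Expansion trees and witnesses\<close>

datatype 'v wire = Pos 'v | Neg 'v

primrec dual_wire :: "'v wire \<Rightarrow> 'v wire" where
  "dual_wire (Pos v) = Neg v"
| "dual_wire (Neg v) = Pos v"

text \<open>
  Formal sums are multisets; nonemptiness is enforced by typing.
  \<open>OrL t\<close> and \<open>OrR t\<close> stand for $(t \lor *)$ and $(* \lor t)$.
\<close>

datatype 'v tree =
    One
  | Exp "'v witness multiset"
  | Or "'v tree" "'v tree"
  | OrL "'v tree"
  | OrR "'v tree"
and 'v witness =
    Wire "'v wire"
  | Tensor "'v tree" "'v tree"

text \<open>
  The parameter \<open>\<tau>\<close> gives the proposition symbol \<open>p\<close> of each dual pair of wire variables,
  which are then of type $[p]$ and $[\bar p]$.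
\<close>

primrec wire_type :: "('v \<Rightarrow> 'p) \<Rightarrow> 'v wire \<Rightarrow> 'p wit_type" where
  "wire_type \<tau> (Pos v) = WAtom (\<tau> v)"
| "wire_type \<tau> (Neg v) = WNAtom (\<tau> v)"

inductive has_type :: "('v \<Rightarrow> 'p) \<Rightarrow> 'v tree \<Rightarrow> 'p form \<Rightarrow> bool"
  and has_wit_type :: "('v \<Rightarrow> 'p) \<Rightarrow> 'v witness \<Rightarrow> 'p wit_type \<Rightarrow> bool"
  for \<tau> :: "'v \<Rightarrow> 'p"
where
  one: "has_type \<tau> One Truth"
| exp: "M \<noteq> {#} \<Longrightarrow> \<forall>w\<in>#M. has_wit_type \<tau> w T \<Longrightarrow> has_type \<tau> (Exp M) (underlying T)"
| or: "has_type \<tau> t A \<Longrightarrow> has_type \<tau> s B \<Longrightarrow> has_type \<tau> (Or t s) (Disj A B)"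
| orL: "has_type \<tau> t A \<Longrightarrow> has_type \<tau> (OrL t) (Disj A B)"
| orR: "has_type \<tau> t B \<Longrightarrow> has_type \<tau> (OrR t) (Disj A B)"
| wire: "has_wit_type \<tau> (Wire x) (wire_type \<tau> x)"
| tensor: "has_type \<tau> t A \<Longrightarrow> has_type \<tau> s B \<Longrightarrow> has_wit_type \<tau> (Tensor t s) (WTensor A B)"


section \<open>Typed forests with cut\<close>

text \<open>
  Roots carry their types, because a tree such as \<open>OrL One\<close> has more than one type.
\<close>

datatype ('v, 'p) root =
    Tree "'v tree" "'p form"
  | Wit "'v witness" "'p wit_type"
  | Cut "('v tree \<times> 'p form) uprod"

type_synonym ('v, 'p) forest = "('v, 'p) root multiset"

inductive typed_root :: "('v \<Rightarrow> 'p) \<Rightarrow> ('v, 'p) root \<Rightarrow> bool" for \<tau> :: "'v \<Rightarrow> 'p" where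
  tree: "has_type \<tau> t A \<Longrightarrow> typed_root \<tau> (Tree t A)"
| wit: "has_wit_type \<tau> w T \<Longrightarrow> typed_root \<tau> (Wit w T)"
| cut: "has_type \<tau> t A \<Longrightarrow> has_type \<tau> s (dual A) \<Longrightarrow> A \<noteq> Truth \<Longrightarrow> A \<noteq> Falsity
    \<Longrightarrow> typed_root \<tau> (Cut (Upair (t, A) (s, dual A)))"

lift_definition mset_uprod :: "'a uprod \<Rightarrow> 'a multiset" is "\<lambda>(a, b). {#a, b#}"
  by (auto simp: add_mset_commute)

lemma mset_uprod_Upair [simp]: "mset_uprod (Upair a b) = {#a, b#}"
  by transfer simp

text \<open>The wire variables occurring, with multiplicities.\<close>

primrec tree_wires :: "'v tree \<Rightarrow> 'v wire multiset"
  and wit_wires :: "'v witness \<Rightarrow> 'v wire multiset"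
where
  "tree_wires One = {#}"
| "tree_wires (Exp M) = (\<Sum>w\<in>#M. wit_wires w)"
| "tree_wires (Or t s) = tree_wires t + tree_wires s"
| "tree_wires (OrL t) = tree_wires t"
| "tree_wires (OrR t) = tree_wires t"
| "wit_wires (Wire x) = {#x#}"
| "wit_wires (Tensor t s) = tree_wires t + tree_wires s"

primrec root_wires :: "('v, 'p) root \<Rightarrow> 'v wire multiset" where
  "root_wires (Tree t A) = tree_wires t"
| "root_wires (Wit w T) = wit_wires w"
| "root_wires (Cut c) = (\<Sum>(t, A)\<in>#mset_uprod c. tree_wires t)"

definition forest_wires :: "('v, 'p) forest \<Rightarrow> 'v wire multiset" where
  "forest_wires F = (\<Sum>r\<in>#F. root_wires r)"

definition typed_forest :: "('v \<Rightarrow> 'p) \<Rightarrow> ('v, 'p) forest \<Rightarrow> bool" where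
  "typed_forest \<tau> F \<longleftrightarrow>
     (\<forall>r\<in>#F. typed_root \<tau> r) \<and>
     (\<forall>x. count (forest_wires F) x \<le> 1) \<and>
     (\<forall>x. x \<in># forest_wires F \<longleftrightarrow> dual_wire x \<in># forest_wires F)"

primrec root_type :: "('v, 'p) root \<Rightarrow> 'p type multiset" where
  "root_type (Tree t A) = {#Formula A#}"
| "root_type (Wit w T) = {#Witness T#}"
| "root_type (Cut c) = {#}"

definition forest_type :: "('v, 'p) forest \<Rightarrow> 'p type multiset" where
  "forest_type F = (\<Sum>r\<in>#F. root_type r)"


section \<open>Substitution\<close>

text \<open>
  Trees other than expansions have no summands; when the cut $(x) \bowtie t$ is well typed,
  \<open>t\<close> has an atomic type and hence is an expansion.
\<close>

fun summands :: "'v tree \<Rightarrow> 'v witness multiset" where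
  "summands (Exp M) = M"
| "summands _ = {#}"

text \<open>
  Replacing a wire variable \<open>y\<close> by a sum \<open>N\<close>; a single summand becomes a sum, and the
  sums are flattened.
\<close>

primrec subst_tree :: "'v wire \<Rightarrow> 'v witness multiset \<Rightarrow> 'v tree \<Rightarrow> 'v tree"
  and subst_summand :: "'v wire \<Rightarrow> 'v witness multiset \<Rightarrow> 'v witness \<Rightarrow> 'v witness multiset"
where
  "subst_tree y N One = One"
| "subst_tree y N (Exp M) = Exp (\<Sum>w\<in>#M. subst_summand y N w)"
| "subst_tree y N (Or t s) = Or (subst_tree y N t) (subst_tree y N s)"
| "subst_tree y N (OrL t) = OrL (subst_tree y N t)"
| "subst_tree y N (OrR t) = OrR (subst_tree y N t)"
| "subst_summand y N (Wire z) = (if z = y then N else {#Wire z#})"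
| "subst_summand y N (Tensor t s) = {#Tensor (subst_tree y N t) (subst_tree y N s)#}"

fun subst_root :: "'v wire \<Rightarrow> 'v tree \<Rightarrow> ('v, 'p) root \<Rightarrow> ('v, 'p) root" where
  "subst_root y t (Tree s A) = Tree (subst_tree y (summands t) s) A"
| "subst_root y t (Wit (Wire z) T) =
     (if z = y then Tree t (underlying T) else Wit (Wire z) T)"
| "subst_root y t (Wit (Tensor r s) T) =
     Wit (Tensor (subst_tree y (summands t) r) (subst_tree y (summands t) s)) T"
| "subst_root y t (Cut c) = Cut (map_uprod (map_prod (subst_tree y (summands t)) id) c)"

definition subst_forest :: "'v wire \<Rightarrow> 'v tree \<Rightarrow> ('v, 'p) forest \<Rightarrow> ('v, 'p) forest" where
  "subst_forest y t F = image_mset (subst_root y t) F"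


section \<open>Closures\<close>

text \<open>The members of a multiset, with repeated elements distinguished by an index.\<close>

definition members :: "'a multiset \<Rightarrow> ('a \<times> nat) set" where
  "members M = {(a, i). i < count M a}"

definition is_closure :: "'p type multiset \<Rightarrow> 'p type multiset \<Rightarrow> bool" where
  "is_closure \<Gamma>' \<Gamma> \<longleftrightarrow>
     (\<exists>f. inj_on f (members \<Gamma>') \<and> f ` members \<Gamma>' \<subseteq> members \<Gamma> \<and>
        (\<forall>r\<in>members \<Gamma>'. fst r = fst (f r) \<or>
           (\<exists>T. fst (f r) = Witness T \<and> fst r = Formula (underlying T))))"


section \<open>AC-correctness\<close>

datatype 'v node =
    TreeNode "'v tree"
  | WitNode "'v witness"
  | StarNode
  | CutNode "'v tree uprod"

primrec tree_succs :: "'v tree \<Rightarrow> 'v node multiset" where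
  "tree_succs One = {#}"
| "tree_succs (Exp M) = image_mset WitNode M"
| "tree_succs (Or t s) = {#TreeNode t, TreeNode s#}"
| "tree_succs (OrL t) = {#TreeNode t, StarNode#}"
| "tree_succs (OrR t) = {#StarNode, TreeNode t#}"

primrec wit_succs :: "'v witness \<Rightarrow> 'v node multiset" where
  "wit_succs (Wire x) = {#}"
| "wit_succs (Tensor t s) = {#TreeNode t, TreeNode s#}"

primrec succs :: "'v node \<Rightarrow> 'v node multiset" where
  "succs (TreeNode t) = tree_succs t"
| "succs (WitNode w) = wit_succs w"
| "succs StarNode = {#}"
| "succs (CutNode c) = image_mset TreeNode (mset_uprod c)"

primrec root_node :: "('v, 'p) root \<Rightarrow> 'v node" where
  "root_node (Tree t A) = TreeNode t"
| "root_node (Wit w T) = WitNode w"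
| "root_node (Cut c) = CutNode (map_uprod fst c)"

text \<open>
  An occurrence of a node is represented by the path leading from it to its root: its head
  is the node itself, its tail is the occurrence of the predecessor (empty for a root), and
  the indices distinguish equal siblings.
\<close>

type_synonym 'v occ = "('v node \<times> nat) list"

inductive_set occs :: "('v, 'p) forest \<Rightarrow> 'v occ set" for F :: "('v, 'p) forest" where
  root: "m \<in> members (image_mset root_node F) \<Longrightarrow> [m] \<in> occs F"
| succ: "p \<in> occs F \<Longrightarrow> m \<in> members (succs (fst (hd p))) \<Longrightarrow> m # p \<in> occs F"

definition node_at :: "'v occ \<Rightarrow> 'v node" where
  "node_at p = fst (hd p)"

fun switched :: "'v node \<Rightarrow> bool" where
  "switched (TreeNode (Exp M)) \<longleftrightarrow> True"
| "switched (TreeNode (Or t s)) \<longleftrightarrow> True"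
| "switched _ \<longleftrightarrow> False"

definition is_switching :: "('v, 'p) forest \<Rightarrow> ('v occ \<Rightarrow> 'v occ) \<Rightarrow> bool" where
  "is_switching F \<sigma> \<longleftrightarrow>
     (\<forall>p\<in>occs F. switched (node_at p) \<longrightarrow> \<sigma> p \<in> occs F \<and> tl (\<sigma> p) = p)"

definition switching_graph :: "('v, 'p) forest \<Rightarrow> ('v occ \<Rightarrow> 'v occ) \<Rightarrow> 'v occ set set" where
  "switching_graph F \<sigma> =
     {{q, tl q} | q. q \<in> occs F \<and> tl q \<noteq> [] \<and> (switched (node_at (tl q)) \<longrightarrow> \<sigma> (tl q) = q)} \<union>
     {{p, q} | p q x. p \<in> occs F \<and> q \<in> occs F \<and>
        node_at p = WitNode (Wire x) \<and> node_at q = WitNode (Wire (dual_wire x))}"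

text \<open>
  The edges are two-element sets and there are no parallel edges, so cycles have length at
  least 3.
\<close>

definition is_cycle :: "'a set set \<Rightarrow> 'a list \<Rightarrow> bool" where
  "is_cycle E vs \<longleftrightarrow>
     length vs \<ge> 3 \<and> distinct vs \<and>
     (\<forall>i. Suc i < length vs \<longrightarrow> {vs ! i, vs ! Suc i} \<in> E) \<and> {last vs, hd vs} \<in> E"

definition acyclic_graph :: "'a set set \<Rightarrow> bool" where
  "acyclic_graph E \<longleftrightarrow> \<not> (\<exists>vs. is_cycle E vs)"

definition AC :: "('v, 'p) forest \<Rightarrow> bool" where
  "AC F \<longleftrightarrow> (\<forall>\<sigma>. is_switching F \<sigma> \<longrightarrow> acyclic_graph (switching_graph F \<sigma>))"

end

theory Submission
  imports Defs
begin

text \<open>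
  The tree \<open>t\<close> that is cut against \<open>(x)\<close> has an atomic formula as its type, so it is a sum
  of wire variables \<open>y\<^sub>1 + \<dots> + y\<^sub>n\<close> (\<open>has_type_dual_wire\<close>). The dual of \<open>x\<close> cannot be one of
  them: otherwise the switching that selects it in \<open>t\<close> closes a cycle through the cut
  (\<open>dual_wire_notin_Y\<close>). Hence the dual \<open>y\<close> of \<open>x\<close> occurs, exactly once, in \<open>F\<close>, and the
  substitution puts the leaves \<open>y\<^sub>1, \<dots>, y\<^sub>n\<close> in place of the leaf \<open>y\<close>. Types and the linearity of
  wire variables are preserved by inspection of the rules, and the type of the forest changes
  only if \<open>y\<close> is itself a root, whose witness type then becomes its underlying formula.

  For AC-correctness, take a switching of the new forest and a cycle in its switching graph. The
  nodes of the new forest are nodes of \<open>G\<close>: the leaves \<open>y\<^sub>i\<close> are the summands of \<open>t\<close>, and the other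
  nodes come from nodes of \<open>F\<close>. All edges are edges of \<open>G\<close>, except those between a leaf \<open>y\<^sub>i\<close> and its
  new parent \<open>e\<close>. If \<open>y\<close> was a root, that parent is an expansion without a predecessor, so it has
  only one neighbour and lies on no cycle. Otherwise the edge is in the graph only if \<open>y\<^sub>i\<close> is the
  choice at \<open>e\<close>. Let the switching of \<open>G\<close> choose \<open>y\<close> at \<open>e\<close> and \<open>y\<^sub>i\<close> at \<open>t\<close>; then \<open>G\<close> has the path
  \<open>y\<^sub>i, t, (x) \<bowtie> t, (x), x, y, e\<close>, which replaces the edge. So \<open>G\<close> has a cycle too
  (\<open>core_lifts\<close>).

  Replacing an edge of a cycle by a path is easier for sets of vertices than for sequences.
  Therefore cycles are exchanged for finite nonempty sets in which each vertex has two neighbours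
  (\<open>acyclic_graph_iff_no_core\<close>); such a set is transported vertex by vertex.
\<close>


section \<open>Cycles and vertices of degree two\<close>

text \<open>
  The vertex sets of finite subgraphs of minimum degree at least two: a form of cyclicity that does
  not depend on an order of traversal.
\<close>

definition is_core :: "'a set set \<Rightarrow> 'a set \<Rightarrow> bool" where
  "is_core E C \<longleftrightarrow> finite C \<and> C \<noteq> {} \<and>
     (\<forall>v\<in>C. \<exists>u\<in>C. \<exists>w\<in>C. u \<noteq> v \<and> w \<noteq> v \<and> u \<noteq> w \<and> {v, u} \<in> E \<and> {v, w} \<in> E)"

lemma is_core_set_cycle:
  assumes "is_cycle E vs"
  shows "is_core E (set vs)"
  unfolding is_core_def
proof (intro conjI ballI)
  let ?n = "length vs"
  have n: "?n \<ge> 3" and d: "distinct vs"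
    and e: "\<And>i. Suc i < ?n \<Longrightarrow> {vs ! i, vs ! Suc i} \<in> E" and l: "{last vs, hd vs} \<in> E"
    using assms unfolding is_cycle_def by auto
  show "finite (set vs)" by simp
  show "set vs \<noteq> {}" using n by auto
  have l': "{vs ! (?n - 1), vs ! 0} \<in> E"
    using l n by (metis hd_conv_nth last_conv_nth list.size(3) not_numeral_le_zero)
  fix v assume "v \<in> set vs"
  then obtain i where i: "i < ?n" "v = vs ! i" by (auto simp: in_set_conv_nth)
  let ?s = "if Suc i < ?n then Suc i else 0"
  let ?p = "if i = 0 then ?n - 1 else i - 1"
  have "{v, vs ! ?s} \<in> E"
  proof (cases "Suc i < ?n")
    case True then show ?thesis using e i by auto
  next
    case False
    then have "i = ?n - 1" using i by simp
    then show ?thesis using l' i False by simp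
  qed
  moreover have "{v, vs ! ?p} \<in> E"
  proof (cases i)
    case 0 then show ?thesis using l' i by (simp add: insert_commute)
  next
    case (Suc k) then show ?thesis using e[of k] i by (simp add: insert_commute)
  qed
  moreover have "?s < ?n" "?p < ?n" "?s \<noteq> i" "?p \<noteq> i" "?s \<noteq> ?p" using n i by auto
  moreover from this have "vs ! ?s \<noteq> v" "vs ! ?p \<noteq> v" "vs ! ?s \<noteq> vs ! ?p"
    "vs ! ?s \<in> set vs" "vs ! ?p \<in> set vs"
    using d i by (simp_all only: nth_eq_iff_index_eq nth_mem not_False_eq_True)
  ultimately show "\<exists>u\<in>set vs. \<exists>w\<in>set vs.
      u \<noteq> v \<and> w \<noteq> v \<and> u \<noteq> w \<and> {v, u} \<in> E \<and> {v, w} \<in> E"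
    by blast
qed

text \<open>
  The first vertex of a longest path has all its neighbours in \<open>C\<close> on the path. One of its two neighbours
  is not the second vertex, and the path up to that neighbour is a cycle.
\<close>

lemma core_contains_cycle:
  assumes "is_core E C"
  shows "\<exists>vs. is_cycle E vs"
proof -
  define path where "path vs \<longleftrightarrow> vs \<noteq> [] \<and> distinct vs \<and> set vs \<subseteq> C \<and>
    (\<forall>i. Suc i < length vs \<longrightarrow> {vs ! i, vs ! Suc i} \<in> E)" for vs
  have C: "finite C" "C \<noteq> {}" and nb: "\<And>v. v \<in> C \<Longrightarrow>
      \<exists>u\<in>C. \<exists>w\<in>C. u \<noteq> v \<and> w \<noteq> v \<and> u \<noteq> w \<and> {v, u} \<in> E \<and> {v, w} \<in> E"
    using assms unfolding is_core_def by auto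
  obtain c where "c \<in> C" using C by auto
  then have start: "path [c]" by (simp add: path_def)
  have bound: "\<forall>vs. path vs \<longrightarrow> length vs < Suc (card C)"
    unfolding path_def by (metis C(1) card_mono distinct_card le_imp_less_Suc)
  obtain vs where vs: "path vs" and longest: "\<And>us. path us \<Longrightarrow> length us \<le> length vs"
    using ex_has_greatest_nat[of path _ length, OF start] bound by blast
  obtain v ws where vw: "vs = v # ws" using vs by (cases vs) (auto simp: path_def)
  have "v \<in> C" using vs vw by (simp add: path_def)
  (* A neighbour of the first vertex that is not on the longest path would prolong it. *)
  have on_path: "u \<in> set vs" if "u \<in> C" "{v, u} \<in> E" for u
  proof (rule ccontr)
    assume "u \<notin> set vs"
    then have "path (u # vs)"
      using vs that vw by (auto simp: path_def nth_Cons insert_commute split: nat.split)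
    then show False using longest by fastforce
  qed
  obtain u where u: "u \<in> C" "u \<noteq> v" "{v, u} \<in> E" "ws \<noteq> [] \<longrightarrow> u \<noteq> hd ws"
    using nb[OF \<open>v \<in> C\<close>] by metis
  obtain j where j: "j < length vs" "u = vs ! j"
    using on_path u by (metis in_set_conv_nth)
  have "j \<noteq> 0" using j u vw by (cases j) auto
  moreover have "j \<noteq> 1" using j u vw by (cases ws) auto
  ultimately have j2: "j \<ge> 2" by simp
  have "is_cycle E (take (Suc j) vs)"
    unfolding is_cycle_def
  proof (intro conjI allI impI)
    show "3 \<le> length (take (Suc j) vs)" using j j2 by simp
    show "distinct (take (Suc j) vs)" using vs by (simp add: path_def)
    show "{take (Suc j) vs ! i, take (Suc j) vs ! Suc i} \<in> E"
      if "Suc i < length (take (Suc j) vs)" for i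
      using that vs by (simp add: path_def)
    have "last (take (Suc j) vs) = u" using j by (simp add: take_Suc_conv_app_nth)
    moreover have "hd (take (Suc j) vs) = v" using vw by simp
    ultimately show "{last (take (Suc j) vs), hd (take (Suc j) vs)} \<in> E"
      using u by (simp add: insert_commute)
  qed
  then show ?thesis by blast
qed

lemma acyclic_graph_iff_no_core:
  "acyclic_graph E \<longleftrightarrow> (\<nexists>C. is_core E C)"
  unfolding acyclic_graph_def using core_contains_cycle is_core_set_cycle by blast


section \<open>Members of multisets and closures\<close>

lemma members_add_mset: "members (add_mset a M) = insert (a, count M a) (members M)"
  by (auto simp: members_def split: if_splits)

lemma members_empty [simp]: "members {#} = {}"
  by (simp add: members_def)

lemma fst_members: "m \<in> members M \<Longrightarrow> fst m \<in># M"
  by (auto simp: members_def intro: count_inI)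

lemma members_zero: "a \<in># M \<Longrightarrow> (a, 0) \<in> members M"
  by (simp add: members_def)

lemma members_mono: "M \<subseteq># N \<Longrightarrow> members M \<subseteq> members N"
  by (auto simp: members_def subseteq_mset_def intro: less_le_trans)

lemma members_union_disjoint:
  "m \<in> members (M + N) \<Longrightarrow> set_mset M \<inter> set_mset N = {} \<Longrightarrow> m \<in> members M \<or> m \<in> members N"
  by (cases m, auto simp: members_def)
     (metis IntI add.right_neutral add_cancel_left_left count_eq_zero_iff empty_iff)

lemma count_image_mset_inj_on:
  assumes "inj_on f (set_mset M)" and "a \<in># M"
  shows "count (image_mset f M) (f a) = count M a"
proof -
  have "{b \<in> set_mset M. f b = f a} = {a}" using assms by (auto simp: inj_on_def)
  then show ?thesis by (simp add: count_image_mset vimage_def Int_def conj_commute)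
qed

text \<open>
  Injectivity keeps the index range of each element: distinct elements with the same image would
  have their multiplicities added.
\<close>

lemma members_image_mset:
  assumes "inj_on f (set_mset M)"
  shows "members (image_mset f M) = map_prod f id ` members M"
proof (intro equalityI subsetI)
  fix m assume m: "m \<in> members (image_mset f M)"
  obtain a where a: "a \<in># M" "fst m = f a" using fst_members[OF m] by fastforce
  then have "(a, snd m) \<in> members M"
    using m count_image_mset_inj_on[OF assms a(1)] by (simp add: members_def case_prod_unfold)
  moreover have "m = map_prod f id (a, snd m)" using a by (simp add: prod_eq_iff)
  ultimately show "m \<in> map_prod f id ` members M" by (rule rev_image_eqI)
next
  fix m assume "m \<in> map_prod f id ` members M"
  then obtain a i where "m = (f a, i)" "(a, i) \<in> members M" by auto
  then show "m \<in> members (image_mset f M)"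
    using fst_members[of "(a, i)" M] count_image_mset_inj_on[OF assms, of a]
    by (simp add: members_def)
qed

text \<open>
  The new members are matched with each other. They carry the largest indices of their types, so
  the given injection does not touch them.
\<close>

lemma is_closure_add_mset:
  assumes "is_closure \<Gamma>' \<Gamma>"
    and "S' = S \<or> (\<exists>T. S = Witness T \<and> S' = Formula (underlying T))"
  shows "is_closure (add_mset S' \<Gamma>') (add_mset S \<Gamma>)"
proof -
  obtain f where f: "inj_on f (members \<Gamma>')" "f ` members \<Gamma>' \<subseteq> members \<Gamma>"
    "\<forall>r\<in>members \<Gamma>'. fst r = fst (f r) \<or>
       (\<exists>T. fst (f r) = Witness T \<and> fst r = Formula (underlying T))"
    using assms(1) unfolding is_closure_def by blast
  have new': "(S', count \<Gamma>' S') \<notin> members \<Gamma>'" and new: "(S, count \<Gamma> S) \<notin> members \<Gamma>"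
    by (auto simp: members_def)
  let ?f = "f((S', count \<Gamma>' S') := (S, count \<Gamma> S))"
  have "inj_on ?f (members (add_mset S' \<Gamma>'))"
    using f(1,2) new new' by (auto simp: members_add_mset inj_on_def)
  moreover have "?f ` members (add_mset S' \<Gamma>') \<subseteq> members (add_mset S \<Gamma>)"
    using f(2) by (auto simp: members_add_mset)
  moreover have "\<forall>r\<in>members (add_mset S' \<Gamma>'). fst r = fst (?f r) \<or>
       (\<exists>T. fst (?f r) = Witness T \<and> fst r = Formula (underlying T))"
    using f(3) assms(2) by (simp add: members_add_mset)
  ultimately show ?thesis unfolding is_closure_def by blast
qed

lemma is_closure_subst_forest:
  "is_closure (forest_type (subst_forest y t F)) (forest_type F)"
proof (induction F)
  case empty
  show ?case by (simp add: subst_forest_def forest_type_def is_closure_def)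
next
  case (add r F)
  then show ?case
    by (cases "(y, t, r)" rule: subst_root.cases)
       (auto simp: subst_forest_def forest_type_def intro: is_closure_add_mset)
qed


section \<open>Substitution preserves types\<close>

text \<open>
  A witness turns into a sum of witnesses of the same type. That the sum is nonempty is part of the
  induction, since the typing of expansions asks for it.
\<close>

lemma has_type_subst:
  assumes "N \<noteq> {#}" and "\<forall>w\<in>#N. has_wit_type \<tau> w (wire_type \<tau> y)"
  shows has_type_subst_tree: "has_type \<tau> s A \<Longrightarrow> has_type \<tau> (subst_tree y N s) A"
    and has_wit_type_subst_summand: "has_wit_type \<tau> w T \<Longrightarrow>
      subst_summand y N w \<noteq> {#} \<and> (\<forall>v\<in>#subst_summand y N w. has_wit_type \<tau> v T)"
proof (induction rule: has_type_has_wit_type.inducts)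
  case (exp M T)
  obtain w where "w \<in># M" using exp by auto
  then have "(\<Sum>w\<in>#M. subst_summand y N w) \<noteq> {#}" using exp by auto
  moreover have "\<forall>v\<in>#(\<Sum>w\<in>#M. subst_summand y N w). has_wit_type \<tau> v T"
    using exp by auto
  ultimately show ?case unfolding subst_tree.simps by (rule has_type_has_wit_type.exp)
next
  case one
  then show ?case by (simp add: has_type_has_wit_type.one)
next
  case or
  then show ?case by (simp add: has_type_has_wit_type.or)
next
  case orL
  then show ?case by (simp add: has_type_has_wit_type.orL)
next
  case orR
  then show ?case by (simp add: has_type_has_wit_type.orR)
next
  case (wire x)
  then show ?case using assms by (simp add: has_type_has_wit_type.wire)
next
  case tensor
  then show ?case by (simp add: has_type_has_wit_type.tensor)
qed

lemma typed_root_subst_root: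
  assumes "typed_root \<tau> r" and "N \<noteq> {#}" and "\<forall>w\<in>#N. has_wit_type \<tau> w (wire_type \<tau> y)"
  shows "typed_root \<tau> (subst_root y (Exp N) r)"
  using assms(1)
proof cases
  case (wit w T)
  show ?thesis
  proof (cases w)
    case (Wire z)
    then show ?thesis
      using wit assms(2,3)
      by (auto elim: has_wit_type.cases intro: typed_root.intros has_type_has_wit_type.exp)
  next
    case (Tensor a b)
    then show ?thesis
      using wit has_wit_type_subst_summand[OF assms(2,3), of w T]
      by (auto intro: typed_root.intros)
  qed
next
  case (cut t A s)
  then show ?thesis
    using typed_root.cut[of \<tau> "subst_tree y N t" A "subst_tree y N s"]
      has_type_subst_tree[OF assms(2,3)]
    by simp
qed (use has_type_subst_tree[OF assms(2,3)] in \<open>auto intro: typed_root.intros\<close>)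

text \<open>
  Atomic formulae are the underlying formulae of atomic witness types only, and those are the types
  of wire variables but not of tensors.
\<close>

lemma has_type_dual_wire:
  assumes "has_type \<tau> t (dual (underlying (wire_type \<tau> x)))"
  obtains Y where "Y \<noteq> {#}" and "t = Exp (image_mset Wire Y)"
    and "\<forall>z\<in>#Y. wire_type \<tau> z = wire_type \<tau> (dual_wire x)"
proof -
  have d: "dual (underlying (wire_type \<tau> x)) = underlying (wire_type \<tau> (dual_wire x))"
    by (cases x) auto
  obtain M T where M: "t = Exp M" "M \<noteq> {#}" "\<forall>w\<in>#M. has_wit_type \<tau> w T"
    "underlying T = underlying (wire_type \<tau> (dual_wire x))"
    using assms unfolding d by (cases x) (auto elim: has_type.cases)
  have T: "T = wire_type \<tau> (dual_wire x)"
    using M(4) by (cases x; cases T) auto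
  have "\<exists>z. w = Wire z \<and> wire_type \<tau> z = T" if "w \<in># M" for w
  proof -
    have "has_wit_type \<tau> w T" using M that by blast
    then show ?thesis by cases (use T in \<open>cases x; auto\<close>)+
  qed
  then obtain f where f: "\<And>w. w \<in># M \<Longrightarrow> w = Wire (f w) \<and> wire_type \<tau> (f w) = T"
    by metis
  have "image_mset Wire (image_mset f M) = M"
    using f by (simp add: multiset.map_comp o_def multiset.map_ident_strong)
  then show ?thesis
    using that[of "image_mset f M"] M f T by auto
qed


section \<open>Wire variables and substitution\<close>

lemma sum_mset_sum_mset: "(\<Sum>z\<in>#(\<Sum>w\<in>#M. f w). g z) = (\<Sum>w\<in>#M. \<Sum>z\<in>#f w. g z)"
  by (induction M) auto

lemma mset_uprod_map_uprod: "mset_uprod (map_uprod f c) = image_mset f (mset_uprod c)"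
  by (cases c) simp

primrec node_wires :: "'v node \<Rightarrow> 'v wire multiset" where
  "node_wires (TreeNode s) = tree_wires s"
| "node_wires (WitNode w) = wit_wires w"
| "node_wires StarNode = {#}"
| "node_wires (CutNode c) = (\<Sum>s\<in>#mset_uprod c. tree_wires s)"

lemma node_wires_root_node: "node_wires (root_node r) = root_wires r"
  by (cases r) (simp_all add: mset_uprod_map_uprod multiset.map_comp o_def case_prod_unfold)

lemma forest_wires_root_nodes:
  "forest_wires F = (\<Sum>n\<in>#image_mset root_node F. node_wires n)"
  by (simp add: forest_wires_def multiset.map_comp o_def node_wires_root_node)

text \<open>
  Equality fails only for a leaf that is a wire variable.
\<close>

lemma wires_of_succs: "(\<Sum>n\<in>#succs m. node_wires n) \<subseteq># node_wires m"
proof (cases m)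
  case (TreeNode s) then show ?thesis by (cases s) (simp_all add: multiset.map_comp o_def)
next
  case (WitNode w) then show ?thesis by (cases w) simp_all
qed (simp_all add: multiset.map_comp o_def)

lemma wires_of_member: "n \<in># S \<Longrightarrow> node_wires n \<subseteq># (\<Sum>n\<in>#S. node_wires n)"
  by (metis image_mset_add_mset insert_DiffM mset_subset_eq_add_left sum_mset.insert)

text \<open>
  A wire variable that occurs once overall lies in one summand, and that summand is not repeated.
\<close>

lemma member_of_wire_unique:
  assumes "(n, i) \<in> members S" "(n', i') \<in> members S"
    and "z \<in># node_wires n" "z \<in># node_wires n'"
    and lin: "count (\<Sum>n\<in>#S. node_wires n) z \<le> 1"
  shows "(n, i) = (n', i')"
proof -
  obtain R where S: "S = add_mset n R" using fst_members[OF assms(1)] by (auto dest: mset_add)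
  have "count (\<Sum>n\<in>#R. node_wires n) z = 0"
    using lin count_greater_zero_iff[THEN iffD2, OF assms(3)] unfolding S
    by (simp del: count_greater_zero_iff)
  then have "z \<notin># (\<Sum>n\<in>#R. node_wires n)" by (simp only: not_in_iff not_False_eq_True)
  then have R: "m \<notin># R" if "z \<in># node_wires m" for m
    using that wires_of_member mset_subset_eqD by metis
  have "n \<notin># R" "n' \<notin># R" using R assms(3,4) by auto
  moreover from this have "n' = n" using fst_members[OF assms(2)] S by simp
  ultimately show ?thesis using assms(1,2) S by (simp add: members_def not_in_iff)
qed

text \<open>
  On wire variables, substitution is the bind operation of the multiset monad.
\<close>

lemma tree_wires_subst_tree:
  "tree_wires (subst_tree y N s) =
    (\<Sum>z\<in>#tree_wires s. if z = y then \<Sum>w\<in>#N. wit_wires w else {#z#})"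
  and wit_wires_subst_summand:
  "(\<Sum>v\<in>#subst_summand y N w. wit_wires v) =
    (\<Sum>z\<in>#wit_wires w. if z = y then \<Sum>w\<in>#N. wit_wires w else {#z#})"
proof (induction s and w rule: tree.induct witness.induct)
  case (Exp M)
  then show ?case
    unfolding tree_wires.simps subst_tree.simps sum_mset_sum_mset
    by (simp cong: image_mset_cong)
qed simp_all

lemma subst_tree_id: "y \<notin># tree_wires s \<Longrightarrow> subst_tree y N s = s"
  and subst_summand_id: "y \<notin># wit_wires w \<Longrightarrow> subst_summand y N w = {#w#}"
proof (induction s and w rule: tree.induct witness.induct)
  case (Exp M)
  have "image_mset (subst_summand y N) M = image_mset (\<lambda>w. {#w#}) M"
    using Exp by (intro image_mset_cong) auto
  then show ?case by simp
qed auto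

lemma sum_mset_replace_once:
  assumes "count W y = 1"
  shows "(\<Sum>z\<in>#W. if z = y then Y else {#z#}) = (W - {#y#}) + Y"
proof -
  obtain V where V: "W = add_mset y V" "y \<notin># V"
    using assms by (metis Suc_inject count_add_mset One_nat_def count_greater_zero_iff
        mset_add not_in_iff zero_less_one)
  then have "image_mset (\<lambda>z. if z = y then Y else {#z#}) V = image_mset (\<lambda>z. {#z#}) V"
    by (intro image_mset_cong) auto
  then show ?thesis using V by simp
qed


section \<open>Occurrences\<close>

lemma root_occ_iff: "[m] \<in> occs F \<longleftrightarrow> m \<in> members (image_mset root_node F)"
  by (auto intro: occs.root elim: occs.cases)

lemma Nil_not_occ [simp]: "[] \<notin> occs F"
  by (auto elim: occs.cases)

lemma Cons_occ_iff:
  "p \<noteq> [] \<Longrightarrow> m # p \<in> occs F \<longleftrightarrow> p \<in> occs F \<and> m \<in> members (succs (node_at p))"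
  unfolding node_at_def by (auto intro: occs.succ elim: occs.cases)

lemma tl_occ: "p \<in> occs F \<Longrightarrow> tl p \<noteq> [] \<Longrightarrow> tl p \<in> occs F"
  by (auto elim: occs.cases)

lemma last_occ: "p \<in> occs F \<Longrightarrow> last p \<in> members (image_mset root_node F)"
  by (induction rule: occs.induct) auto

lemma occs_mono: "p \<in> occs F \<Longrightarrow> F \<subseteq># G \<Longrightarrow> p \<in> occs G"
proof (induction rule: occs.induct)
  case (root m)
  then show ?case using members_mono[OF image_mset_subseteq_mono] by (blast intro: occs.root)
qed (auto intro: occs.succ)

lemma wires_of_occ: "p \<in> occs F \<Longrightarrow> node_wires (node_at p) \<subseteq># forest_wires F"
proof (induction rule: occs.induct)
  case (root m)
  then show ?case
    using wires_of_member[OF fst_members[OF root]]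
    by (simp add: node_at_def forest_wires_root_nodes)
next
  case (succ p m)
  then show ?case
    using subset_mset.order_trans[OF wires_of_member[OF fst_members[OF succ.hyps(2)]]
        subset_mset.order_trans[OF wires_of_succs]]
    by (simp add: node_at_def)
qed

lemma wires_of_tl:
  assumes "p \<in> occs F" "tl p \<noteq> []"
  shows "node_wires (node_at p) \<subseteq># node_wires (node_at (tl p))"
  using assms(1)
proof cases
  case (succ q m)
  then show ?thesis
    using subset_mset.order_trans[OF wires_of_member[OF fst_members[OF succ(3)]] wires_of_succs]
    by (simp add: node_at_def)
qed (use assms in auto)

lemma drop_occ:
  "p \<in> occs F \<Longrightarrow> k < length p \<Longrightarrow>
     drop k p \<in> occs F \<and> node_wires (node_at p) \<subseteq># node_wires (node_at (drop k p))"
proof (induction k)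
  case (Suc k)
  then have "drop k p \<in> occs F" "tl (drop k p) \<noteq> []"
    and "node_wires (node_at p) \<subseteq># node_wires (node_at (drop k p))"
    by (auto simp: tl_drop drop_Suc)
  then show ?case
    using tl_occ[of "drop k p"] wires_of_tl[of "drop k p"]
    by (auto simp: drop_Suc tl_drop intro: subset_mset.order_trans)
qed simp

text \<open>
  Two occurrences of the same length that contain \<open>z\<close> are equal, by induction along the path: the
  roots agree and each step leads to the same successor. Of two occurrences of the leaf \<open>z\<close> with
  different lengths, the shorter one would then be a proper suffix of the longer one, although a
  leaf has no successors.
\<close>

lemma occ_of_wire_unique:
  assumes lin: "count (forest_wires F) z \<le> 1"
    and p: "p \<in> occs F" "node_at p = WitNode (Wire z)"
    and q: "q \<in> occs F" "node_at q = WitNode (Wire z)"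
  shows "p = q"
proof -
  have same_depth: "p \<in> occs F \<Longrightarrow> z \<in># node_wires (node_at p) \<Longrightarrow>
      q \<in> occs F \<Longrightarrow> z \<in># node_wires (node_at q) \<Longrightarrow> length p = length q \<Longrightarrow> p = q" for p q
  proof (induction arbitrary: q rule: occs.induct)
    case (root m)
    then obtain m' where m': "q = [m']" by (cases q) auto
    then have "m' \<in> members (image_mset root_node F)" using root by (simp add: root_occ_iff)
    then show ?case
      using root m' member_of_wire_unique[of "fst m" "snd m" _ "fst m'" "snd m'" z]
        lin[unfolded forest_wires_root_nodes]
      by (auto simp: node_at_def)
  next
    case (succ p m)
    then obtain m' q' where q': "q = m' # q'" "q' \<noteq> []" by (cases q; cases "tl q") auto
    have mem: "m' \<in> members (succs (node_at q'))" "q' \<in> occs F"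
      using succ.prems(2) q' by (auto simp: Cons_occ_iff)
    have "z \<in># node_wires (node_at p)"
      using wires_of_tl[OF occs.succ[OF succ.hyps]] succ.hyps(1) succ.prems(1)
      by (cases p) (auto dest: mset_subset_eqD)
    moreover have "z \<in># node_wires (node_at q')"
      using wires_of_tl[of "m' # q'" F] succ.prems q' by (auto dest: mset_subset_eqD)
    ultimately have eq: "p = q'" using succ.IH mem succ.prems q' by simp
    have "count (\<Sum>n\<in>#succs (node_at p). node_wires n) z \<le> 1"
      using wires_of_succs[of "node_at p"] wires_of_occ[OF succ.hyps(1)] lin
      by (meson le_trans mset_subset_eq_count)
    then show ?case
      using succ mem q' eq
        member_of_wire_unique[of "fst m" "snd m" _ "fst m'" "snd m'" z]
      by (auto simp: node_at_def)
  qed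
  have "length q \<le> length p" if p: "p \<in> occs F" "node_at p = WitNode (Wire z)"
    and q: "q \<in> occs F" "node_at q = WitNode (Wire z)" for p q
  proof (rule ccontr)
    assume len: "\<not> ?thesis"
    define k where "k = length q - length p"
    have "length p > 0" using p by (cases p) auto
    then have k: "0 < k" "k < length q" using len unfolding k_def by linarith+
    have "drop k q = p"
      using same_depth[of "drop k q" p] drop_occ[OF q(1) k(2)] p q k len
      by (auto simp: k_def)
    moreover have "drop (k - 1) q \<in> occs F" "tl (drop (k - 1) q) = drop k q"
      using drop_occ[OF q(1), of "k - 1"] k by (auto simp: tl_drop drop_Suc[symmetric])
    ultimately have "\<exists>m. m # p \<in> occs F"
      using \<open>length p > 0\<close> by (metis Nil_not_occ list.exhaust_sel)
    then show False using p \<open>length p > 0\<close> by (auto simp: Cons_occ_iff)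
  qed
  from this[OF p q] this[OF q p] show ?thesis using same_depth[of p q] p q by simp
qed

lemma wire_occurs_below_tree:
    "z \<in># tree_wires s \<Longrightarrow> p \<in> occs F \<Longrightarrow> node_at p = TreeNode s \<Longrightarrow>
      \<exists>q\<in>occs F. node_at q = WitNode (Wire z)"
  and wire_occurs_below_witness:
    "z \<in># wit_wires w \<Longrightarrow> p \<in> occs F \<Longrightarrow> node_at p = WitNode w \<Longrightarrow>
      \<exists>q\<in>occs F. node_at q = WitNode (Wire z)"
proof (induction s and w arbitrary: p and p rule: tree.induct witness.induct)
  case One then show ?case by simp
next
  case (Exp M)
  then obtain w where w: "w \<in># M" "z \<in># wit_wires w" by auto
  have "(WitNode w, 0) # p \<in> occs F"
    using Exp.prems w(1) by (auto simp: node_at_def intro!: occs.succ members_zero)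
  then show ?case using Exp.IH w by (metis node_at_def fst_conv list.sel(1))
next
  case (Or s s')
  have "(TreeNode s, 0) # p \<in> occs F" "(TreeNode s', 0) # p \<in> occs F"
    using Or.prems by (auto simp: node_at_def intro!: occs.succ members_zero)
  then show ?case
    using Or.IH Or.prems(1) by (metis node_at_def fst_conv list.sel(1) tree_wires.simps(3) union_iff)
next
  case (OrL s)
  have "(TreeNode s, 0) # p \<in> occs F"
    using OrL.prems by (auto simp: node_at_def intro!: occs.succ members_zero)
  then show ?case
    using OrL.IH OrL.prems(1) by (metis node_at_def fst_conv list.sel(1) tree_wires.simps(4))
next
  case (OrR s)
  have "(TreeNode s, 0) # p \<in> occs F"
    using OrR.prems by (auto simp: node_at_def intro!: occs.succ members_zero)
  then show ?case
    using OrR.IH OrR.prems(1) by (metis node_at_def fst_conv list.sel(1) tree_wires.simps(5))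
next
  case (Wire x) then show ?case by auto
next
  case (Tensor s s')
  have "(TreeNode s, 0) # p \<in> occs F" "(TreeNode s', 0) # p \<in> occs F"
    using Tensor.prems by (auto simp: node_at_def intro!: occs.succ members_zero)
  then show ?case
    using Tensor.IH Tensor.prems(1)
    by (metis node_at_def fst_conv list.sel(1) wit_wires.simps(2) union_iff)
qed

lemma wire_has_occ:
  assumes "z \<in># forest_wires F"
  shows "\<exists>q\<in>occs F. node_at q = WitNode (Wire z)"
proof -
  obtain n where n: "n \<in># image_mset root_node F" "z \<in># node_wires n"
    using assms unfolding forest_wires_root_nodes by auto
  then have p: "[(n, 0)] \<in> occs F" by (blast intro: occs.root members_zero)
  show ?thesis
  proof (cases n)
    case (TreeNode s)
    then show ?thesis using wire_occurs_below_tree[OF _ p] n by (simp add: node_at_def)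
  next
    case (WitNode w)
    then show ?thesis using wire_occurs_below_witness[OF _ p] n by (simp add: node_at_def)
  next
    case (CutNode c)
    then obtain s where s: "s \<in># mset_uprod c" "z \<in># tree_wires s" using n by auto
    then have "[(TreeNode s, 0), (n, 0)] \<in> occs F"
      using p CutNode by (auto intro!: occs.succ members_zero)
    then show ?thesis by (rule wire_occurs_below_tree[OF s(2)]) (simp add: node_at_def)
  qed (use n in simp)
qed


section \<open>Switchings\<close>

text \<open>
  Typing makes every expansion nonempty, so that each switched node has a successor to choose.
\<close>

lemma typed_forest_has_switching:
  assumes "typed_forest \<tau> F"
  obtains \<sigma> where "is_switching F \<sigma>"
proof -
  define typed_node where "typed_node n \<longleftrightarrow> (case n of
      TreeNode s \<Rightarrow> \<exists>A. has_type \<tau> s A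
    | WitNode w \<Rightarrow> \<exists>T. has_wit_type \<tau> w T
    | StarNode \<Rightarrow> True
    | CutNode c \<Rightarrow> \<forall>s\<in>#mset_uprod c. \<exists>A. has_type \<tau> s A)" for n
  have typed: "typed_node (node_at p)" if "p \<in> occs F" for p
    using that
  proof (induction rule: occs.induct)
    case (root m)
    then obtain r where r: "r \<in># F" "fst m = root_node r" using fst_members by fastforce
    then have "typed_root \<tau> r" using assms by (simp add: typed_forest_def)
    then show ?case using r by cases (auto simp: typed_node_def node_at_def)
  next
    case (succ p m)
    have "n \<in># succs k \<Longrightarrow> typed_node k \<Longrightarrow> typed_node n" for n k
    proof (induction k)
      case (TreeNode s)
      then obtain A where "has_type \<tau> s A" by (auto simp: typed_node_def)
      then show ?case using TreeNode(1) by cases (auto simp: typed_node_def, blast)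
    next
      case (WitNode w)
      then obtain A where "has_wit_type \<tau> w A" by (auto simp: typed_node_def)
      then show ?case using WitNode(1) by cases (auto simp: typed_node_def)
    qed (auto simp: typed_node_def)
    then show ?case using succ fst_members by (fastforce simp: node_at_def)
  qed
  have "\<exists>q. q \<in> occs F \<and> tl q = p" if p: "p \<in> occs F" "switched (node_at p)" for p
  proof -
    have "\<exists>n. n \<in># succs (node_at p)"
      using typed[OF p(1)] p(2)
      by (cases "node_at p" rule: switched.cases)
         (auto simp: typed_node_def elim: has_type.cases)
    then obtain n where "(n, 0) # p \<in> occs F"
      using p(1) by (auto simp: node_at_def intro!: occs.succ members_zero)
    then show ?thesis by (metis list.sel(3))
  qed
  then have "is_switching F (\<lambda>p. SOME q. q \<in> occs F \<and> tl q = p)"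
    unfolding is_switching_def by (metis (mono_tags, lifting) someI_ex)
  then show ?thesis using that by blast
qed

lemma dual_wire_dual_wire [simp]: "dual_wire (dual_wire x) = x"
  by (cases x) auto

lemma dual_wire_neq [simp]: "dual_wire x \<noteq> x" "x \<noteq> dual_wire x"
  by (cases x; simp)+

lemma switching_edge_cases:
  assumes "{p, q} \<in> switching_graph F \<sigma>"
  obtains (up) "p \<in> occs F" "q = tl p" "q \<noteq> []" "switched (node_at q) \<longrightarrow> \<sigma> q = p"
  | (down) "q \<in> occs F" "p = tl q" "p \<noteq> []" "switched (node_at p) \<longrightarrow> \<sigma> p = q"
  | (axiom) z where "p \<in> occs F" "q \<in> occs F"
      "node_at p = WitNode (Wire z)" "node_at q = WitNode (Wire (dual_wire z))"
  using assms unfolding switching_graph_def doubleton_eq_iff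
  by (auto simp: doubleton_eq_iff) (metis dual_wire_dual_wire)+

lemma parent_edge:
  "q \<in> occs F \<Longrightarrow> tl q \<noteq> [] \<Longrightarrow> (switched (node_at (tl q)) \<Longrightarrow> \<sigma> (tl q) = q) \<Longrightarrow>
    {q, tl q} \<in> switching_graph F \<sigma>"
  unfolding switching_graph_def by blast

lemma axiom_edge:
  "p \<in> occs F \<Longrightarrow> q \<in> occs F \<Longrightarrow> node_at p = WitNode (Wire z) \<Longrightarrow>
    node_at q = WitNode (Wire (dual_wire z)) \<Longrightarrow> {p, q} \<in> switching_graph F \<sigma>"
  unfolding switching_graph_def by blast


section \<open>Occurrences after a substitution\<close>

text \<open>
  The node that stands in a root position after the substitution; in this position the wire variable
  \<open>y\<close> becomes an expansion. Below an expansion, where \<open>y\<close> is instead replaced by the summands,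
  \<open>succs_subst_node\<close> treats it separately.
\<close>

fun subst_node :: "'v wire \<Rightarrow> 'v witness multiset \<Rightarrow> 'v node \<Rightarrow> 'v node" where
  "subst_node y N (TreeNode s) = TreeNode (subst_tree y N s)"
| "subst_node y N (WitNode (Wire z)) =
     (if z = y then TreeNode (Exp N) else WitNode (Wire z))"
| "subst_node y N (WitNode (Tensor r s)) =
     WitNode (Tensor (subst_tree y N r) (subst_tree y N s))"
| "subst_node y N StarNode = StarNode"
| "subst_node y N (CutNode c) = CutNode (map_uprod (subst_tree y N) c)"

lemma root_node_subst_root:
  "root_node (subst_root y (Exp N) r) = subst_node y N (root_node r)"
proof (cases "(y, Exp N, r)" rule: subst_root.cases)
  case (4 y t c)
  then show ?thesis by (cases c) auto
qed auto

lemma root_nodes_subst_forest: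
  "image_mset root_node (subst_forest y (Exp N) F) =
    image_mset (subst_node y N) (image_mset root_node F)"
  by (simp add: subst_forest_def multiset.map_comp o_def root_node_subst_root)

lemma node_wires_subst_node:
  "node_wires (subst_node y N n) =
    (\<Sum>z\<in>#node_wires n. if z = y then \<Sum>w\<in>#N. wit_wires w else {#z#})"
proof (cases n)
  case (WitNode w)
  then show ?thesis by (cases w) (simp_all add: tree_wires_subst_tree)
next
  case (CutNode c)
  then show ?thesis by (cases c) (simp add: tree_wires_subst_tree)
qed (simp_all add: tree_wires_subst_tree)

lemma subst_node_id: "y \<notin># node_wires n \<Longrightarrow> subst_node y N n = n"
proof (cases n)
  case (WitNode w)
  then show "y \<notin># node_wires n \<Longrightarrow> ?thesis" by (cases w) (simp_all add: subst_tree_id)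
next
  case (CutNode c)
  then show "y \<notin># node_wires n \<Longrightarrow> ?thesis" by (cases c) (simp add: subst_tree_id)
qed (simp_all add: subst_tree_id)

lemma switched_subst_node: "switched n \<Longrightarrow> switched (subst_node y N n)"
  by (cases n rule: switched.cases) auto

lemma subst_node_eq_Wire:
  "subst_node y N n = WitNode (Wire z) \<Longrightarrow> n = WitNode (Wire z)"
  by (cases "(y, N, n)" rule: subst_node.cases) (auto split: if_splits)

lemma succs_subst_node:
  assumes "n \<noteq> WitNode (Wire y)"
  shows "succs (subst_node y N n) =
    image_mset (subst_node y N) (filter_mset (\<lambda>m. m \<noteq> WitNode (Wire y)) (succs n)) +
    repeat_mset (count (succs n) (WitNode (Wire y))) (image_mset WitNode N)"
proof (cases n)
  case (TreeNode s)
  show ?thesis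
  proof (cases s)
    case (Exp M)
    have "image_mset WitNode (\<Sum>w\<in>#M. subst_summand y N w) =
      image_mset (subst_node y N)
        (filter_mset (\<lambda>m. m \<noteq> WitNode (Wire y)) (image_mset WitNode M)) +
      repeat_mset (count (image_mset WitNode M) (WitNode (Wire y))) (image_mset WitNode N)"
    proof (induction M)
      case (add w M)
      then show ?case by (cases w) (auto simp: ac_simps)
    qed simp
    then show ?thesis using TreeNode Exp by simp
  qed (use TreeNode in simp_all)
next
  case (WitNode w)
  then show ?thesis using assms by (cases w) auto
next
  case (CutNode c)
  then show ?thesis by (cases c) simp
qed simp

lemma sum_filter_mset_subset:
  fixes f :: "'a \<Rightarrow> 'b multiset"
  shows "(\<Sum>n\<in>#filter_mset P S. f n) \<subseteq># (\<Sum>n\<in>#S. f n)"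
proof -
  have "(\<Sum>n\<in>#S. f n) =
      (\<Sum>n\<in>#filter_mset P S. f n) + (\<Sum>n\<in>#filter_mset (\<lambda>n. \<not> P n) S. f n)"
    by (induction S) (auto simp: ac_simps)
  then show ?thesis by simp
qed

text \<open>
  The linear forest \<open>F\<close>, in which the one occurrence of \<open>y\<close> is to be replaced by the sum of the
  fresh wire variables \<open>Y\<close>.
\<close>

locale wire_substitution =
  fixes F :: "('v, 'p) forest" and y :: "'v wire" and Y :: "'v wire multiset"
  assumes linear: "count (forest_wires F) z \<le> 1"
    and occurs: "y \<in># forest_wires F"
    and fresh: "z \<in># Y \<Longrightarrow> z \<notin># forest_wires F"
    and distinct_Y: "count Y z \<le> 1"
    and nonempty: "Y \<noteq> {#}"
begin

abbreviation summands_Y :: "'v witness multiset" where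
  "summands_Y \<equiv> image_mset Wire Y"

abbreviation F' :: "('v, 'p) forest" where
  "F' \<equiv> subst_forest y (Exp summands_Y) F"

abbreviation sub :: "'v node \<Rightarrow> 'v node" where
  "sub \<equiv> subst_node y summands_Y"

text \<open>
  An occurrence contains the whole subterm at each node on its path, so the substitution changes all
  nodes from the place of \<open>y\<close> down to the root; the indices stay the same.
\<close>

abbreviation subst_occ :: "'v occ \<Rightarrow> 'v occ" where
  "subst_occ \<equiv> map (map_prod sub id)"

definition y_occ :: "'v occ" where
  "y_occ = (SOME p. p \<in> occs F \<and> node_at p = WitNode (Wire y))"

text \<open>
  The occurrence of \<open>F\<close> that becomes the parent of the new leaves: the expansion with the summand
  \<open>y\<close>, or \<open>y\<close> itself if it is a root.
\<close>

definition anchor :: "'v occ" where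
  "anchor = (if tl y_occ = [] then y_occ else tl y_occ)"

definition new_leaf :: "'v occ \<Rightarrow> bool" where
  "new_leaf q \<longleftrightarrow> (\<exists>z\<in>#Y. node_at q = WitNode (Wire z))"

lemma y_occ: "y_occ \<in> occs F" "node_at y_occ = WitNode (Wire y)"
  using someI_ex[of "\<lambda>p. p \<in> occs F \<and> node_at p = WitNode (Wire y)"] wire_has_occ[OF occurs]
  unfolding y_occ_def by blast+

lemma y_occ_unique: "p \<in> occs F \<Longrightarrow> node_at p = WitNode (Wire y) \<Longrightarrow> p = y_occ"
  using occ_of_wire_unique[OF linear] y_occ by blast

lemma anchor_occ: "anchor \<in> occs F"
  using y_occ tl_occ unfolding anchor_def by auto

lemma inj_on_sub:
  assumes S: "(\<Sum>n\<in>#S. node_wires n) \<subseteq># forest_wires F"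
  shows "inj_on sub (set_mset S)"
proof -
  obtain z where z: "z \<in># Y" using nonempty by auto
  (* Only a node in which y occurs changes, and it acquires the variables of Y, which occur
     in no node of F. *)
  have wires_Y: "(\<Sum>w\<in>#summands_Y. wit_wires w) = Y" by (simp add: multiset.map_comp o_def)
  have not_in: "z \<notin># node_wires n" if "n \<in># S" for n
    using fresh[OF z] wires_of_member[OF that] S by (meson mset_subset_eqD)
  have new: "z \<in># node_wires (sub n)" if "y \<in># node_wires n" for n
    unfolding node_wires_subst_node wires_Y using that z by auto
  have "n = n'" if n: "n \<in># S" "n' \<in># S" "sub n = sub n'" for n n'
  proof -
    have "count (\<Sum>n\<in>#S. node_wires n) y \<le> 1"
      using S linear[of y] by (meson le_trans mset_subset_eq_count)
    then have "n = n'" if "y \<in># node_wires n" "y \<in># node_wires n'"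
      using member_of_wire_unique[OF members_zero[OF n(1)] members_zero[OF n(2)] that] by simp
    moreover have "y \<in># node_wires n \<longleftrightarrow> y \<in># node_wires n'"
      using new n not_in subst_node_id by metis
    ultimately show ?thesis using n(3) subst_node_id by metis
  qed
  then show ?thesis by (simp add: inj_on_def)
qed

lemma inj_on_sub_roots: "inj_on sub (set_mset (image_mset root_node F))"
  by (rule inj_on_sub) (simp only: forest_wires_root_nodes subset_mset.order_refl)

lemma wires_of_succs_occ:
  "p \<in> occs F \<Longrightarrow> (\<Sum>n\<in>#succs (node_at p). node_wires n) \<subseteq># forest_wires F"
  using wires_of_succs wires_of_occ by (meson subset_mset.order_trans)

text \<open>
  Induction along the path: the substitution identifies neither two roots nor two siblings.
\<close>

lemma inj_on_subst_occ: "inj_on subst_occ (occs F)"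
proof -
  have "p \<in> occs F \<Longrightarrow> p' \<in> occs F \<Longrightarrow> subst_occ p = subst_occ p' \<Longrightarrow> p = p'" for p p'
  proof (induction arbitrary: p' rule: occs.induct)
    case (root m)
    then obtain m' where m': "p' = [m']" "map_prod sub id m = map_prod sub id m'"
      by (cases m) auto
    then have "m' \<in> members (image_mset root_node F)" using root by (simp add: root_occ_iff)
    then have "fst m' \<in># image_mset root_node F" by (rule fst_members)
    moreover have "sub (fst m) = sub (fst m')" using m'(2) by (metis fst_map_prod)
    ultimately have "fst m = fst m'"
      using inj_onD[OF inj_on_sub_roots] fst_members[OF root.hyps] by blast
    then show ?case using m' by (cases m; cases m') simp
  next
    case (succ p m)
    obtain m' q where p': "p' = m' # q" using succ.prems(2) by (cases p') simp_all
    have q: "map_prod sub id m = map_prod sub id m'" "subst_occ p = subst_occ q"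
      using succ.prems(2) unfolding p' list.map list.inject by blast+
    have "p \<noteq> []" using succ.hyps(1) by auto
    then have "q \<noteq> []" using q by auto
    then have "q \<in> occs F" "m' \<in> members (succs (node_at q))"
      using succ.prems(1) p' by (simp_all add: Cons_occ_iff)
    moreover from this have "p = q" using succ.IH q by blast
    ultimately have "fst m \<in># succs (node_at p)" "fst m' \<in># succs (node_at p)"
      using fst_members[OF succ.hyps(2)] fst_members[of m'] by (simp_all add: node_at_def)
    moreover have "sub (fst m) = sub (fst m')" using q(1) by (metis fst_map_prod)
    ultimately have "fst m = fst m'"
      using inj_onD[OF inj_on_sub[OF wires_of_succs_occ[OF succ.hyps(1)]]] by blast
    then show ?case using p' q(1) \<open>p = q\<close> by (cases m; cases m') simp
  qed
  then show ?thesis by (simp add: inj_on_def)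
qed

lemma node_at_subst_occ: "p \<noteq> [] \<Longrightarrow> node_at (subst_occ p) = sub (node_at p)"
  by (cases p) (auto simp: node_at_def)

lemma not_new_leaf_subst_occ:
  assumes "p \<in> occs F"
  shows "\<not> new_leaf (subst_occ p)"
proof
  assume "new_leaf (subst_occ p)"
  moreover have "p \<noteq> []" using assms by auto
  ultimately obtain z where z: "z \<in># Y" "node_at p = WitNode (Wire z)"
    unfolding new_leaf_def by (auto simp: node_at_subst_occ dest: subst_node_eq_Wire)
  then show False using wires_of_occ[OF assms] fresh[OF z(1)] by simp
qed

text \<open>
  Substitution commutes with taking successors, except that at the anchor the successor \<open>y\<close> is
  exchanged for the new leaves; so induction along the path applies. If \<open>y\<close> is a root, its
  occurrence survives as the root \<open>Exp summands_Y\<close>.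
\<close>

lemma occ_subst_forest_cases:
  assumes "q \<in> occs F'"
  obtains (new) z where "z \<in># Y" "q = (WitNode (Wire z), 0) # subst_occ anchor"
  | (old) p where "p \<in> occs F" "q = subst_occ p" "tl y_occ = [] \<or> p \<noteq> y_occ"
proof -
  have "(\<exists>z\<in>#Y. q = (WitNode (Wire z), 0) # subst_occ anchor) \<or>
      (\<exists>p\<in>occs F. q = subst_occ p \<and> (tl y_occ = [] \<or> p \<noteq> y_occ))"
    using assms
  proof (induction rule: occs.induct)
    case (root m)
    then have "m \<in> map_prod sub id ` members (image_mset root_node F)"
      unfolding root_nodes_subst_forest members_image_mset[OF inj_on_sub_roots] .
    then obtain m' where "m' \<in> members (image_mset root_node F)" "m = map_prod sub id m'" by auto
    then have "[m'] \<in> occs F" "[m] = subst_occ [m']" by (auto intro: occs.root)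
    then show ?case by (metis list.sel(3))
  next
    case (succ q m)
    have "\<not> (\<exists>z\<in>#Y. q = (WitNode (Wire z), 0) # subst_occ anchor)"
      using succ.hyps(2) by auto
    then obtain p where p: "p \<in> occs F" "q = subst_occ p" "tl y_occ = [] \<or> p \<noteq> y_occ"
      using succ.IH by blast
    then have "p \<noteq> []" by auto
    have m: "m \<in> members (succs (sub (node_at p)))"
      using succ.hyps(2) p node_at_subst_occ[OF \<open>p \<noteq> []\<close>] by (simp add: node_at_def)
    let ?y = "WitNode (Wire y) :: 'v node"
    (* The variables of Y are distinct, so every new leaf has index 0. *)
    have new: "\<exists>z\<in>#Y. m = (WitNode (Wire z), 0)"
      if m: "m \<in> members (image_mset WitNode summands_Y)"
    proof -
      have "count (image_mset WitNode summands_Y) (WitNode (Wire z)) = count Y z" if "z \<in># Y" for z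
        using count_image_mset_inj_on[of "\<lambda>z. WitNode (Wire z)" Y z] that
        by (simp add: inj_on_def multiset.map_comp o_def)
      moreover obtain z where z: "z \<in># Y" "fst m = WitNode (Wire z)"
        using fst_members[OF m] by auto
      ultimately have "snd m < count Y z"
        using m by (simp add: members_def case_prod_unfold)
      then have "snd m = 0" using distinct_Y[of z] by simp
      then show ?thesis using z by (metis prod.collapse)
    qed
    show ?case
    proof (cases "node_at p = ?y")
      case True
      then have "anchor = p" using p y_occ_unique unfolding anchor_def by auto
      then show ?thesis using new m True p by auto
    next
      case False
      let ?S = "filter_mset (\<lambda>n. n \<noteq> ?y) (succs (node_at p))"
      have S: "(\<Sum>n\<in>#?S. node_wires n) \<subseteq># forest_wires F"
        by (rule subset_mset.order_trans[OF sum_filter_mset_subset wires_of_succs_occ[OF p(1)]])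
      have "count (\<Sum>n\<in>#succs (node_at p). node_wires n) y \<le> 1"
        using wires_of_succs_occ[OF p(1)] linear[of y] by (meson le_trans mset_subset_eq_count)
      have y_child: "count (succs (node_at p)) ?y \<le> 1"
      proof (rule ccontr)
        assume "\<not> ?thesis"
        then have "(?y, 0) \<in> members (succs (node_at p))" "(?y, 1) \<in> members (succs (node_at p))"
          by (simp_all add: members_def del: count_greater_zero_iff)
        then show False
          using member_of_wire_unique[of ?y 0 _ ?y 1 y]
            \<open>count (\<Sum>n\<in>#succs (node_at p). node_wires n) y \<le> 1\<close> by auto
      qed
      (* Old successors and new leaves are different nodes, since Y is fresh; hence neither kind
         shifts the indices of the other. *)
      have disj: "set_mset (image_mset sub ?S) \<inter>
          set_mset (repeat_mset (count (succs (node_at p)) ?y) (image_mset WitNode summands_Y)) = {}"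
      proof -
        have "sub n \<noteq> WitNode (Wire z)" if "n \<in># ?S" "z \<in># Y" for n z
          using subst_node_eq_Wire[of y summands_Y n z] wires_of_member[OF that(1)] S fresh[OF that(2)]
          by (auto dest: mset_subset_eqD)
        moreover have "n \<in># M" if "n \<in># repeat_mset k M" for n :: "'v node" and k M
          using that by (metis count_eq_zero_iff count_repeat_mset mult_0_right)
        ultimately show ?thesis by fastforce
      qed
      consider (child) "m \<in> members (image_mset sub ?S)"
        | (leaf) "m \<in> members
            (repeat_mset (count (succs (node_at p)) ?y) (image_mset WitNode summands_Y))"
        using members_union_disjoint[OF m[unfolded succs_subst_node[OF False]] disj] by blast
      then show ?thesis
      proof cases
        case child
        then obtain n i where n: "(n, i) \<in> members ?S" "m = (sub n, i)"
          unfolding members_image_mset[OF inj_on_sub[OF S]] by auto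
        then have "(n, i) \<in> members (succs (node_at p))" "n \<noteq> ?y"
          using members_mono[OF multiset_filter_subset] fst_members[OF n(1)] by auto
        then have "(n, i) # p \<in> occs F" "node_at ((n, i) # p) \<noteq> node_at y_occ"
          using p(1) y_occ(2) by (simp_all add: node_at_def occs.succ)
        then have "(n, i) # p \<in> occs F" "(n, i) # p \<noteq> y_occ" by metis+
        moreover have "m # q = subst_occ ((n, i) # p)" using n p by simp
        ultimately show ?thesis by metis
      next
        case leaf
        then have c: "count (succs (node_at p)) ?y = 1"
          using y_child by (cases "count (succs (node_at p)) ?y") auto
        then have "(?y, 0) # p \<in> occs F"
          using p(1) by (auto simp: node_at_def members_def intro: occs.succ)
        then have "(?y, 0) # p = y_occ" by (intro y_occ_unique) (auto simp: node_at_def)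
        then have "anchor = p" using \<open>p \<noteq> []\<close> unfolding anchor_def by (metis list.sel(3))
        then show ?thesis using new leaf c p by auto
      qed
    qed
  qed
  then show ?thesis using that by blast
qed

lemma new_leaf_occ:
  assumes "q \<in> occs F'" "new_leaf q"
  obtains z where "z \<in># Y" "q = (WitNode (Wire z), 0) # subst_occ anchor"
  using assms by (cases rule: occ_subst_forest_cases) (auto simp: not_new_leaf_subst_occ)

lemma old_occ:
  assumes "q \<in> occs F'" "\<not> new_leaf q"
  obtains p where "p \<in> occs F" "q = subst_occ p" "tl y_occ = [] \<or> p \<noteq> y_occ"
  using assms by (cases rule: occ_subst_forest_cases) (auto simp: new_leaf_def node_at_def)

text \<open>
  The parent of the new leaves is an expansion: only expansions have witnesses as successors.
\<close>

lemma anchor_switched: "switched (node_at (subst_occ anchor))"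
proof (cases "tl y_occ = []")
  case True
  have "y_occ \<noteq> []" using y_occ(1) by auto
  then show ?thesis
    using True y_occ(2) by (simp add: anchor_def node_at_subst_occ)
next
  case False
  have "y_occ \<noteq> []" using y_occ(1) by auto
  then have "hd y_occ # tl y_occ \<in> occs F" using y_occ(1) by simp
  then have "hd y_occ \<in> members (succs (node_at anchor))"
    using False by (simp add: anchor_def Cons_occ_iff)
  then have "WitNode (Wire y) \<in># succs (node_at anchor)"
    using fst_members y_occ(2) unfolding node_at_def by metis
  then have "switched (node_at anchor)"
    by (cases "(y, summands_Y, node_at anchor)" rule: subst_node.cases;
        cases "node_at anchor" rule: switched.cases) auto
  moreover have "anchor \<noteq> []" using anchor_occ by auto
  ultimately show ?thesis by (simp add: node_at_subst_occ switched_subst_node)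
qed

end


section \<open>A cut against a wire variable\<close>

locale atomic_cut =
  fixes F :: "('v, 'p) forest" and x :: "'v wire" and Y :: "'v wire multiset"
    and A B :: "'p form"
  assumes x_notin_Y: "x \<notin># Y"
begin

abbreviation t :: "'v tree" where
  "t \<equiv> Exp (image_mset Wire Y)"

abbreviation cut_node :: "'v node" where
  "cut_node \<equiv> CutNode (Upair (Exp {#Wire x#}) t)"

definition G :: "('v, 'p) forest" where
  "G = add_mset (Cut (Upair (Exp {#Wire x#}, A) (t, B))) F"

text \<open>
  The index is the one that the additional root receives after all equal roots of \<open>F\<close>; it keeps this
  occurrence apart from those of \<open>F\<close>.
\<close>

definition cut_occ :: "'v occ" where
  "cut_occ = [(cut_node, count (image_mset root_node F) cut_node)]"

definition x_tree_occ :: "'v occ" where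
  "x_tree_occ = (TreeNode (Exp {#Wire x#}), 0) # cut_occ"

definition x_occ :: "'v occ" where
  "x_occ = (WitNode (Wire x), 0) # x_tree_occ"

definition t_occ :: "'v occ" where
  "t_occ = (TreeNode t, 0) # cut_occ"

definition leaf_occ :: "'v wire \<Rightarrow> 'v occ" where
  "leaf_occ z = (WitNode (Wire z), 0) # t_occ"

lemmas cut_occ_defs = cut_occ_def x_tree_occ_def x_occ_def t_occ_def leaf_occ_def

lemma occs_F_subset: "p \<in> occs F \<Longrightarrow> p \<in> occs G"
  using occs_mono[of p F G] mset_subset_eq_add_right[of F] unfolding G_def
  by (metis add_mset_add_single mset_subset_eq_add_left)

lemma cut_occs_in_G: "cut_occ \<in> occs G" "x_tree_occ \<in> occs G" "x_occ \<in> occs G" "t_occ \<in> occs G"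
  and leaf_occ_in_G: "z \<in># Y \<Longrightarrow> leaf_occ z \<in> occs G"
proof -
  show c: "cut_occ \<in> occs G"
    by (simp add: cut_occ_def G_def root_occ_iff members_add_mset)
  show e: "x_tree_occ \<in> occs G" and t: "t_occ \<in> occs G"
    using c unfolding x_tree_occ_def t_occ_def
    by (auto simp: cut_occ_def intro!: occs.succ members_zero)
  show "x_occ \<in> occs G"
    using e unfolding x_occ_def by (auto simp: x_tree_occ_def intro!: occs.succ members_zero)
  show "leaf_occ z \<in> occs G" if "z \<in># Y"
    using t that unfolding leaf_occ_def by (auto simp: t_occ_def intro!: occs.succ members_zero)
qed

lemma last_cut_occs:
  "last cut_occ = hd cut_occ" "last x_tree_occ = hd cut_occ" "last x_occ = hd cut_occ"
  "last t_occ = hd cut_occ" "last (leaf_occ z) = hd cut_occ"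
  by (simp_all add: cut_occ_defs)

text \<open>
  An occurrence lies in \<open>F\<close> or in the cut according to its root, which is its last entry.
\<close>

lemma not_occ_F: "last p = hd cut_occ \<Longrightarrow> p \<notin> occs F"
  using last_occ by (fastforce simp: cut_occ_def members_def)

lemma cut_occs_distinct: "distinct [t_occ, cut_occ, x_tree_occ, x_occ]"
  and leaf_occ_neq: "leaf_occ z \<notin> {t_occ, cut_occ, x_tree_occ, x_occ}"
proof -
  have "Exp {#Wire x#} \<noteq> t"
    using x_notin_Y by (cases Y) auto
  then show "distinct [t_occ, cut_occ, x_tree_occ, x_occ]"
    "leaf_occ z \<notin> {t_occ, cut_occ, x_tree_occ, x_occ}"
    by (auto simp: cut_occ_defs)
qed

text \<open>
  These edges exist for every switching: the cut is unswitched, and \<open>(x)\<close> has a single summand to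
  choose.
\<close>

lemma cut_path:
  assumes \<sigma>: "is_switching G \<sigma>"
  shows "{t_occ, cut_occ} \<in> switching_graph G \<sigma>"
    and "{cut_occ, x_tree_occ} \<in> switching_graph G \<sigma>"
    and "{x_tree_occ, x_occ} \<in> switching_graph G \<sigma>"
proof -
  show "{t_occ, cut_occ} \<in> switching_graph G \<sigma>"
    using parent_edge[of t_occ G \<sigma>] cut_occs_in_G by (simp add: cut_occ_defs node_at_def)
  show "{cut_occ, x_tree_occ} \<in> switching_graph G \<sigma>"
    using parent_edge[of x_tree_occ G \<sigma>] cut_occs_in_G
    by (simp add: cut_occ_defs node_at_def insert_commute)
  have "\<sigma> x_tree_occ \<in> occs G" "tl (\<sigma> x_tree_occ) = x_tree_occ"
    using \<sigma> cut_occs_in_G(2) unfolding is_switching_def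
    by (auto simp: node_at_def x_tree_occ_def)
  moreover from this have "\<sigma> x_tree_occ = hd (\<sigma> x_tree_occ) # x_tree_occ"
    by (metis Nil_not_occ list.collapse)
  ultimately have "hd (\<sigma> x_tree_occ) # x_tree_occ \<in> occs G" by simp
  then have "hd (\<sigma> x_tree_occ) \<in> members {#WitNode (Wire x)#}"
    by (subst (asm) Cons_occ_iff) (auto simp: x_tree_occ_def node_at_def)
  then have "hd (\<sigma> x_tree_occ) = (WitNode (Wire x), 0)"
    by (simp add: members_add_mset)
  then have "\<sigma> x_tree_occ = x_occ"
    using \<open>\<sigma> x_tree_occ = hd (\<sigma> x_tree_occ) # x_tree_occ\<close> by (simp add: x_occ_def)
  then show "{x_tree_occ, x_occ} \<in> switching_graph G \<sigma>"
    using parent_edge[of x_occ G \<sigma>] cut_occs_in_G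
    by (simp add: x_occ_def x_tree_occ_def insert_commute)
qed

text \<open>
  If the dual of \<open>x\<close> were a summand of \<open>t\<close>, the switching that chooses it at \<open>t\<close> would have the cycle
  that consists of this summand, \<open>t\<close>, the cut, \<open>(x)\<close> and \<open>x\<close>.
\<close>

lemma dual_wire_notin_Y:
  assumes "AC G" and \<sigma>: "is_switching G \<sigma>"
  shows "dual_wire x \<notin># Y"
proof
  assume y: "dual_wire x \<in># Y"
  let ?l = "leaf_occ (dual_wire x)"
  let ?\<sigma> = "\<sigma>(t_occ := ?l)"
  let ?E = "switching_graph G ?\<sigma>"
  have \<sigma>': "is_switching G ?\<sigma>"
    using \<sigma> leaf_occ_in_G[OF y] by (auto simp: is_switching_def leaf_occ_def)
  have l: "{?l, t_occ} \<in> ?E"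
    using parent_edge[of ?l G ?\<sigma>] leaf_occ_in_G[OF y] by (simp add: leaf_occ_def t_occ_def)
  have "{x_occ, ?l} \<in> ?E"
    using axiom_edge[of x_occ G ?l x ?\<sigma>] cut_occs_in_G leaf_occ_in_G[OF y]
    by (simp add: leaf_occ_def x_occ_def node_at_def)
  then have "is_cycle ?E [?l, t_occ, cut_occ, x_tree_occ, x_occ]"
    using l cut_path[OF \<sigma>'] cut_occs_distinct leaf_occ_neq
    by (auto simp: is_cycle_def nth_Cons split: nat.splits)
  then show False
    using assms(1) \<sigma>' unfolding AC_def acyclic_graph_def by blast
qed

end


section \<open>Lifting switching graphs along a cut reduction\<close>

locale atomic_cut_reduction =
  wire_substitution F "dual_wire x" Y + atomic_cut F x Y A B
  for F :: "('v, 'p) forest" and x :: "'v wire" and Y :: "'v wire multiset" and A B :: "'p form"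
begin

text \<open>
  The occurrence in \<open>G\<close> from which an occurrence in \<open>F'\<close> comes: for a new leaf the corresponding
  summand of \<open>t\<close>, for all others the preimage under the substitution.
\<close>

definition lift :: "'v occ \<Rightarrow> 'v occ" where
  "lift q = (if new_leaf q then hd q # t_occ else inv_into (occs F) subst_occ q)"

lemma lift_subst_occ: "p \<in> occs F \<Longrightarrow> lift (subst_occ p) = p"
  using inj_on_subst_occ by (simp add: lift_def not_new_leaf_subst_occ)

lemma lift_new_leaf:
  assumes "q \<in> occs F'" "new_leaf q"
  obtains z where "z \<in># Y" "lift q = leaf_occ z" "q = (WitNode (Wire z), 0) # subst_occ anchor"
proof -
  obtain z where z: "z \<in># Y" "q = (WitNode (Wire z), 0) # subst_occ anchor"
    using new_leaf_occ[OF assms] .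
  moreover from this have "lift q = leaf_occ z"
    using assms(2) by (simp add: lift_def leaf_occ_def)
  ultimately show ?thesis using that by blast
qed

lemma lift_old:
  assumes "q \<in> occs F'" "\<not> new_leaf q"
  shows "lift q \<in> occs F" "subst_occ (lift q) = q" "tl y_occ = [] \<or> lift q \<noteq> y_occ"
  using old_occ[OF assms] lift_subst_occ by metis+

lemma lift_in_G: "q \<in> occs F' \<Longrightarrow> lift q \<in> occs G"
  by (metis lift_new_leaf lift_old(1) leaf_occ_in_G occs_F_subset)

lemma inj_on_lift: "inj_on lift (occs F')"
proof (rule inj_onI)
  fix p q assume p: "p \<in> occs F'" and q: "q \<in> occs F'" and eq: "lift p = lift q"
  have "new_leaf p \<longleftrightarrow> new_leaf q"
    using lift_new_leaf[OF p] lift_new_leaf[OF q] lift_old(1)[OF p] lift_old(1)[OF q]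
      not_occ_F last_cut_occs(5) eq by metis
  then show "p = q"
    using lift_new_leaf[OF p] lift_new_leaf[OF q] lift_old(2)[OF p] lift_old(2)[OF q] eq
    by (metis leaf_occ_def list.inject)
qed

lemma lift_notin_cut: "q \<in> occs F' \<Longrightarrow> lift q \<notin> {t_occ, cut_occ, x_tree_occ, x_occ}"
  using lift_new_leaf[of q] lift_old(1)[of q] not_occ_F last_cut_occs leaf_occ_neq
  by (metis insertE emptyE)

lemma lift_neq_y_occ: "q \<in> occs F' \<Longrightarrow> tl y_occ \<noteq> [] \<Longrightarrow> lift q \<noteq> y_occ"
  using lift_new_leaf[of q] lift_old(3)[of q] not_occ_F last_cut_occs(5) y_occ(1) by metis

lemma lift_tl:
  assumes "q \<in> occs F'" "\<not> new_leaf q" "tl q \<noteq> []"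
  shows "tl (lift q) = lift (tl q)" "tl (lift q) \<in> occs F" "subst_occ (tl (lift q)) = tl q"
proof -
  have q: "subst_occ (tl (lift q)) = tl q"
    using lift_old(2)[OF assms(1,2)] by (metis map_tl)
  then have "tl (lift q) \<noteq> []" using assms(3) by auto
  then have "tl (lift q) \<in> occs F" using lift_old(1)[OF assms(1,2)] tl_occ by blast
  then show "tl (lift q) = lift (tl q)" "tl (lift q) \<in> occs F" "subst_occ (tl (lift q)) = tl q"
    using q lift_subst_occ by metis+
qed

lemma node_at_lift_Wire:
  assumes "q \<in> occs F'" "node_at q = WitNode (Wire z)"
  shows "node_at (lift q) = WitNode (Wire z)"
proof (cases "new_leaf q")
  case True
  then obtain z' where "lift q = leaf_occ z'" "q = (WitNode (Wire z'), 0) # subst_occ anchor"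
    using lift_new_leaf[OF assms(1)] by metis
  then show ?thesis using assms(2) by (simp add: leaf_occ_def node_at_def)
next
  case False
  then have "lift q \<noteq> []" using lift_old(1)[OF assms(1)] by auto
  then have "sub (node_at (lift q)) = WitNode (Wire z)"
    using lift_old(2)[OF assms(1) False] node_at_subst_occ assms(2) by metis
  then show ?thesis by (rule subst_node_eq_Wire)
qed

text \<open>
  The lifted core consists of the lifted vertices and, if the core uses the edge between a new leaf
  and its parent, also of the path through the cut that replaces this edge.
\<close>

lemma core_lifts:
  assumes \<sigma>': "is_switching F' \<sigma>'" and C': "is_core (switching_graph F' \<sigma>') C'"
    and \<sigma>0: "is_switching G \<sigma>0"
  obtains \<sigma> C where "is_switching G \<sigma>" "is_core (switching_graph G \<sigma>) C"
proof -
  let ?E' = "switching_graph F' \<sigma>'"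
  have nb: "\<exists>u\<in>C'. \<exists>w\<in>C'. u \<noteq> v \<and> w \<noteq> v \<and> u \<noteq> w \<and> {v, u} \<in> ?E' \<and> {v, w} \<in> ?E'"
    if "v \<in> C'" for v
    using C' that unfolding is_core_def by blast
  have C'_occ: "v \<in> occs F'" if v: "v \<in> C'" for v
  proof -
    obtain u where "{v, u} \<in> ?E'" using nb[OF v] by blast
    then show ?thesis by (cases rule: switching_edge_cases) (auto intro: tl_occ)
  qed
  (* The new leaves whose edge to the parent joins two vertices of the core. *)
  define special where
    "special r \<longleftrightarrow> r \<in> C' \<and> new_leaf r \<and> tl r \<in> C' \<and> {r, tl r} \<in> ?E'" for r
  have special: "tl r = subst_occ anchor" "\<sigma>' (subst_occ anchor) = r" "tl y_occ \<noteq> []"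
    if r: "special r" for r
  proof -
    show tl: "tl r = subst_occ anchor"
      using new_leaf_occ C'_occ r unfolding special_def by (metis list.sel(3))
    show \<sigma>r: "\<sigma>' (subst_occ anchor) = r"
    proof -
      have "{r, subst_occ anchor} \<in> ?E'" using r tl by (simp add: special_def)
      then show ?thesis
      proof (cases rule: switching_edge_cases)
        case up then show ?thesis using anchor_switched by blast
      next
        case down
        then have "tl (tl (subst_occ anchor)) = subst_occ anchor" using tl by simp
        then have "length (subst_occ anchor) - 2 = length (subst_occ anchor)"
          by (metis length_tl diff_diff_left one_add_one)
        then have "length anchor - 2 = length anchor" by (simp only: length_map)
        then have "length anchor = 0" by linarith
        then show ?thesis using anchor_occ by simp
      next
        case axiom then show ?thesis using anchor_switched by simp
      qed
    qed
    show "tl y_occ \<noteq> []"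
    proof
      (* The root that replaces y has a single edge, to its chosen summand. *)
      assume root: "tl y_occ = []"
      then have root': "tl (subst_occ anchor) = []" by (simp add: anchor_def map_tl[symmetric])
      have "u = r" if "{subst_occ anchor, u} \<in> ?E'" for u
        using that
      proof (cases rule: switching_edge_cases)
        case up then show ?thesis using root' by simp
      next
        case down then show ?thesis using anchor_switched \<sigma>r by simp
      next
        case axiom then show ?thesis using anchor_switched by simp
      qed
      then show False using nb[of "subst_occ anchor"] r tl unfolding special_def by metis
    qed
  qed
  have special_unique: "r = r'" if "special r" "special r'" for r r'
    using special(2) that by metis
  (* Where the given switching chooses a new leaf, the lifted one chooses y, and it chooses the
     corresponding summand at t. All remaining choices are those of some switching of G. *)
  define \<sigma> where "\<sigma> p =
    (if p = t_occ \<and> (\<exists>r. special r) then lift (THE r. special r)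
     else if p \<in> occs F \<and> subst_occ p \<in> occs F' then
       (if new_leaf (\<sigma>' (subst_occ p)) then y_occ else lift (\<sigma>' (subst_occ p)))
     else \<sigma>0 p)" for p
  have t_occ_F: "t_occ \<notin> occs F" using not_occ_F last_cut_occs by blast
  have \<sigma>_t: "\<sigma> t_occ = lift r" if "special r" for r
  proof -
    have "(THE r. special r) = r" using that special_unique by blast
    then show ?thesis using that by (auto simp: \<sigma>_def)
  qed
  have \<sigma>_F: "\<sigma> p = (if new_leaf (\<sigma>' (subst_occ p)) then y_occ else lift (\<sigma>' (subst_occ p)))"
    if "p \<in> occs F" "subst_occ p \<in> occs F'" for p
    using that t_occ_F by (auto simp: \<sigma>_def)
  have switching: "is_switching G \<sigma>"
    unfolding is_switching_def
  proof (intro ballI impI)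
    fix p assume p: "p \<in> occs G" "switched (node_at p)"
    consider (t) r where "p = t_occ" "special r"
      | (F) "p \<in> occs F" "subst_occ p \<in> occs F'"
      | (other) "\<sigma> p = \<sigma>0 p"
      unfolding \<sigma>_def by meson
    then show "\<sigma> p \<in> occs G \<and> tl (\<sigma> p) = p"
    proof cases
      case t
      then obtain z where "z \<in># Y" "lift r = leaf_occ z"
        using lift_new_leaf C'_occ unfolding special_def by metis
      then show ?thesis using t \<sigma>_t leaf_occ_in_G by (simp add: leaf_occ_def)
    next
      case F
      let ?s = "\<sigma>' (subst_occ p)"
      have "p \<noteq> []" using F(1) by auto
      then have "switched (node_at (subst_occ p))"
        using p(2) by (simp add: node_at_subst_occ switched_subst_node)
      then have s: "?s \<in> occs F'" "tl ?s = subst_occ p"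
        using \<sigma>' F(2) unfolding is_switching_def by blast+
      show ?thesis
      proof (cases "new_leaf ?s")
        case True
        then have "subst_occ p = subst_occ anchor"
          using new_leaf_occ[OF s(1)] s(2) by (metis list.sel(3))
        then have "p = anchor" using inj_on_subst_occ F(1) anchor_occ by (meson inj_onD)
        then have "tl y_occ = p" using p(2) y_occ(2) by (auto simp: anchor_def split: if_splits)
        then show ?thesis using \<sigma>_F[OF F] True y_occ(1) occs_F_subset by simp
      next
        case False
        have "tl ?s \<noteq> []" using s(2) \<open>p \<noteq> []\<close> by simp
        then have "tl (lift ?s) = p"
          using lift_tl(1)[OF s(1) False] s(2) lift_subst_occ[OF F(1)] by simp
        then show ?thesis using \<sigma>_F[OF F] False lift_in_G[OF s(1)] by simp
      qed
    next
      case other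
      then show ?thesis using p \<sigma>0 unfolding is_switching_def by simp
    qed
  qed
  let ?E = "switching_graph G \<sigma>"
  have parent: "{lift q, lift (tl q)} \<in> ?E"
    if q: "q \<in> occs F'" "\<not> new_leaf q" "tl q \<noteq> []"
      and chosen: "switched (node_at (tl q)) \<longrightarrow> \<sigma>' (tl q) = q" for q
  proof -
    note l = lift_tl[OF q]
    have "tl (lift q) \<noteq> []" using l(2) by auto
    moreover have "\<sigma> (tl (lift q)) = lift q" if "switched (node_at (tl (lift q)))"
    proof -
      have "switched (node_at (tl q))"
        using that l(3) \<open>tl (lift q) \<noteq> []\<close>
        by (metis node_at_subst_occ switched_subst_node)
      then show ?thesis
        using \<sigma>_F[OF l(2)] l(3) chosen tl_occ[OF q(1,3)] q(2) by simp
    qed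
    ultimately show ?thesis
      using parent_edge[OF lift_in_G[OF q(1)]] l(1) by metis
  qed
  have edge: "{lift v, lift u} \<in> ?E"
    if e: "{v, u} \<in> ?E'" and "\<not> (new_leaf u \<and> v = tl u)" "\<not> (new_leaf v \<and> u = tl v)" for u v
    using e
  proof (cases rule: switching_edge_cases)
    case up then show ?thesis using parent[of v] that by simp
  next
    case down then show ?thesis using parent[of u] that by (simp add: insert_commute)
  next
    case (axiom z)
    then show ?thesis using axiom_edge lift_in_G node_at_lift_Wire by metis
  qed
  have anchor: "lift (subst_occ anchor) = tl y_occ" "{tl y_occ, y_occ} \<in> ?E" if r: "special r" for r
  proof -
    have a: "anchor = tl y_occ" using special(3)[OF r] by (simp add: anchor_def)
    then show "lift (subst_occ anchor) = tl y_occ" using lift_subst_occ[OF anchor_occ] by simp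
    have "subst_occ anchor \<in> occs F'"
      using C'_occ r special(1)[OF r] unfolding special_def by metis
    then have "\<sigma> (tl y_occ) = y_occ"
      unfolding a[symmetric] using \<sigma>_F[OF anchor_occ] special(2)[OF r] r
      unfolding special_def by simp
    then show "{tl y_occ, y_occ} \<in> ?E"
      using parent_edge[OF occs_F_subset[OF y_occ(1)] special(3)[OF r], of \<sigma>]
      by (simp add: insert_commute)
  qed
  have leaf: "{lift r, t_occ} \<in> ?E" if r: "special r" for r
  proof -
    obtain z where z: "z \<in># Y" "lift r = leaf_occ z"
      using lift_new_leaf C'_occ r unfolding special_def by metis
    then show ?thesis
      using parent_edge[OF leaf_occ_in_G[OF z(1)], of \<sigma>] \<sigma>_t[OF r]
      by (simp add: leaf_occ_def t_occ_def)
  qed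
  (* The inner vertices of the replacing path. *)
  define P where "P = (if \<exists>r. special r then {t_occ, cut_occ, x_tree_occ, x_occ, y_occ} else {})"
  define C where "C = lift ` C' \<union> P"
  (* The neighbour of lift v that takes the role of the neighbour u of v: the first vertex of the
     replacing path for the two ends of a special edge, and lift u for all other edges. *)
  define g where "g v u = (if new_leaf u \<and> v = tl u then y_occ
    else if new_leaf v \<and> u = tl v then t_occ else lift u)" for v u
  have y_t: "y_occ \<noteq> t_occ" using y_occ(1) t_occ_F by auto
  have lift_notin_P: "lift v \<notin> P" if "v \<in> C'" for v
    using lift_notin_cut[OF C'_occ[OF that]] lift_neq_y_occ[OF C'_occ[OF that]] special(3)
    by (auto simp: P_def)
  have g: "g v u \<in> C" "{lift v, g v u} \<in> ?E"
    and g_neq: "u \<noteq> v \<Longrightarrow> g v u \<noteq> lift v"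
    and g_special: "g v u \<in> P \<Longrightarrow> special v \<and> u = tl v \<and> g v u = t_occ
      \<or> special u \<and> v = tl u \<and> g v u = y_occ"
    if v: "v \<in> C'" and u: "u \<in> C'" and e: "{v, u} \<in> ?E'" for v u
  proof -
    have e': "{u, v} \<in> ?E'" using e by (simp add: insert_commute)
    consider (into) "special u" "v = tl u" "g v u = y_occ"
      | (out) "special v" "u = tl v" "g v u = t_occ"
      | (old) "g v u = lift u" "\<not> (new_leaf u \<and> v = tl u)" "\<not> (new_leaf v \<and> u = tl v)"
      using u v e e' unfolding g_def special_def by metis
    then have "g v u \<in> C \<and> {lift v, g v u} \<in> ?E \<and> (u \<noteq> v \<longrightarrow> g v u \<noteq> lift v) \<and>
      (g v u \<in> P \<longrightarrow> special v \<and> u = tl v \<and> g v u = t_occ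
      \<or> special u \<and> v = tl u \<and> g v u = y_occ)"
    proof cases
      case into
      then have "g v u \<in> P" by (auto simp: P_def)
      moreover have "{lift v, g v u} \<in> ?E"
        using into anchor special(1) by simp
      ultimately show ?thesis using into lift_notin_P[OF v] by (auto simp: C_def)
    next
      case out
      then have "g v u \<in> P" by (auto simp: P_def)
      then show ?thesis using out leaf lift_notin_P[OF v] by (auto simp: C_def)
    next
      case old
      moreover have "lift u \<noteq> lift v" if "u \<noteq> v"
        using that inj_on_lift C'_occ u v by (meson inj_onD)
      ultimately show ?thesis using edge[OF e] u lift_notin_P[OF u] by (auto simp: C_def)
    qed
    then show "g v u \<in> C" "{lift v, g v u} \<in> ?E" "u \<noteq> v \<Longrightarrow> g v u \<noteq> lift v"
      "g v u \<in> P \<Longrightarrow> special v \<and> u = tl v \<and> g v u = t_occ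
      \<or> special u \<and> v = tl u \<and> g v u = y_occ" by blast+
  qed
  (* Two neighbours of v stay different: only one of them can lie across the special edge. *)
  have g_inj: "g v u \<noteq> g v w"
    if v: "v \<in> C'" and u: "u \<in> C'" "{v, u} \<in> ?E'"
      and w: "w \<in> C'" "{v, w} \<in> ?E'" and "u \<noteq> w" for v u w
  proof
    assume eq: "g v u = g v w"
    show False
    proof (cases "g v u \<in> P")
      case True
      then show False
        using g_special[OF v u] g_special[OF v w] eq y_t special_unique \<open>u \<noteq> w\<close> by metis
    next
      case False
      have "k = lift m" if "k = g v m" "k \<notin> P" "m \<in> C'" "{v, m} \<in> ?E'" for k m
      proof -
        have "\<not> (special m \<and> v = tl m)" "\<not> (special v \<and> m = tl v)"
          using that y_t by (auto simp: P_def g_def split: if_splits simp: special_def)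
        then show ?thesis using that v by (auto simp: g_def special_def insert_commute)
      qed
      then have "lift u = lift w" using False eq u w by metis
      then show False using inj_on_lift C'_occ u w \<open>u \<noteq> w\<close> by (meson inj_onD)
    qed
  qed
  have "is_core ?E C"
    unfolding is_core_def
  proof (intro conjI ballI)
    show "finite C" "C \<noteq> {}" using C' by (auto simp: C_def P_def is_core_def)
    fix c assume "c \<in> C"
    moreover have "\<exists>r. special r" if "c \<in> P" using that by (auto simp: P_def split: if_splits)
    ultimately consider (lift) v where "v \<in> C'" "c = lift v" | (path) r where "special r" "c \<in> P"
      unfolding C_def by blast
    then show "\<exists>u\<in>C. \<exists>w\<in>C. u \<noteq> c \<and> w \<noteq> c \<and> u \<noteq> w \<and> {c, u} \<in> ?E \<and> {c, w} \<in> ?E"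
    proof cases
      case lift
      then obtain u w where "u \<in> C'" "w \<in> C'" "u \<noteq> v" "w \<noteq> v" "u \<noteq> w" "{v, u} \<in> ?E'" "{v, w} \<in> ?E'"
        using nb by metis
      then show ?thesis
        using g[of v] g_neq[of v] g_inj[of v] lift by metis
    next
      case path
      note r = path(1)
      have P: "P = {t_occ, cut_occ, x_tree_occ, x_occ, y_occ}" using r by (auto simp: P_def)
      have rC: "r \<in> C'" "subst_occ anchor \<in> C'" using r special(1)[OF r] by (auto simp: special_def)
      have xy: "{x_occ, y_occ} \<in> ?E"
        using axiom_edge[OF cut_occs_in_G(3) occs_F_subset[OF y_occ(1)], of x \<sigma>] y_occ(2)
        by (simp add: x_occ_def node_at_def)
      have dist: "distinct [lift r, t_occ, cut_occ, x_tree_occ, x_occ, y_occ]"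
        using cut_occs_distinct lift_notin_P[OF rC(1)] not_occ_F last_cut_occs y_occ(1)
        by (auto simp: P)
      have end_notin_P: "tl y_occ \<notin> P"
        using lift_notin_P[OF rC(2)] anchor(1)[OF r] by simp
      have in_C: "lift r \<in> C" "tl y_occ \<in> C" "t_occ \<in> C" "cut_occ \<in> C" "x_tree_occ \<in> C"
        "x_occ \<in> C" "y_occ \<in> C"
        using rC(1) imageI[OF rC(2), of lift] anchor(1)[OF r] by (auto simp: C_def P)
      have two: ?thesis
        if "{a, c} \<in> ?E" "{c, b} \<in> ?E" "a \<in> C" "b \<in> C" "distinct [a, c, b]" for a b
        by (intro bexI[of _ a] bexI[of _ b] conjI) (use that in \<open>auto simp: insert_commute\<close>)
      have yt: "{y_occ, tl y_occ} \<in> ?E" using anchor(2)[OF r] by (simp add: insert_commute)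
      note path_edges = leaf[OF r] cut_path[OF switching] xy yt
      consider "c = t_occ" | "c = cut_occ" | "c = x_tree_occ" | "c = x_occ" | "c = y_occ"
        using path(2) unfolding P by blast
      then show ?thesis
      proof cases
        case 1 show ?thesis
          by (rule two[of "lift r" cut_occ]) (use 1 path_edges in_C dist in auto)
      next
        case 2 show ?thesis
          by (rule two[of t_occ x_tree_occ]) (use 2 path_edges in_C dist in auto)
      next
        case 3 show ?thesis
          by (rule two[of cut_occ x_occ]) (use 3 path_edges in_C dist in auto)
      next
        case 4 show ?thesis
          by (rule two[of x_tree_occ y_occ]) (use 4 path_edges in_C dist in auto)
      next
        case 5 show ?thesis
          by (rule two[of x_occ "tl y_occ"])
             (use 5 path_edges in_C dist end_notin_P in \<open>auto simp: P\<close>)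
      qed
    qed
  qed
  with switching show ?thesis using that by blast
qed

lemma AC_subst_forest:
  assumes "AC G" and "is_switching G \<sigma>0"
  shows "AC F'"
  unfolding AC_def acyclic_graph_iff_no_core
  using assms core_lifts unfolding AC_def acyclic_graph_iff_no_core by metis

end


section \<open>Reduction of a cut against a wire variable\<close>

lemma dual_dual: "dual (dual A) = A"
  by (induction A) simp_all

theorem proposition57:
  fixes \<tau> :: "'v \<Rightarrow> 'p"
    and x :: "'v wire"
    and t :: "'v tree"
    and A B :: "'p form"
    and F G :: "('v, 'p) forest"
  assumes "G = add_mset (Cut (Upair (Exp {#Wire x#}, A) (t, B))) F"
    and "typed_forest \<tau> G"
    and "AC G"
  shows "typed_forest \<tau> (subst_forest (dual_wire x) t F)
    \<and> AC (subst_forest (dual_wire x) t F)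
    \<and> is_closure (forest_type (subst_forest (dual_wire x) t F)) (forest_type G)"
proof -
  have typed: "\<forall>r\<in>#G. typed_root \<tau> r"
    and linear_G: "\<And>z. count (forest_wires G) z \<le> 1"
    and closed: "\<And>z. z \<in># forest_wires G \<longleftrightarrow> dual_wire z \<in># forest_wires G"
    using assms(2) unfolding typed_forest_def by blast+
  have "typed_root \<tau> (Cut (Upair (Exp {#Wire x#}, A) (t, B)))" using typed assms(1) by simp
  then have "has_type \<tau> (Exp {#Wire x#}) A \<and> has_type \<tau> t (dual A)"
  proof cases
    case (cut u C s)
    then have "Exp {#Wire x#} = u \<and> A = C \<and> t = s \<or> Exp {#Wire x#} = s \<and> A = dual C \<and> t = u"
      by auto
    then show ?thesis using cut dual_dual by metis
  qed
  then have A: "has_type \<tau> (Exp {#Wire x#}) A" and t: "has_type \<tau> t (dual A)" by simp_all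
  have "A = underlying (wire_type \<tau> x)"
    using A by cases (auto elim: has_wit_type.cases)
  then obtain Y where Y: "Y \<noteq> {#}" "t = Exp (image_mset Wire Y)"
    "\<forall>z\<in>#Y. wire_type \<tau> z = wire_type \<tau> (dual_wire x)"
    using t has_type_dual_wire by metis
  have wires_G: "forest_wires G = add_mset x (Y + forest_wires F)"
    using assms(1) Y(2) by (simp add: forest_wires_def multiset.map_comp o_def)
  have x: "x \<notin># Y" "x \<notin># forest_wires F"
    using linear_G[of x] by (auto simp: wires_G not_in_iff)
  interpret cut: atomic_cut F x Y A B by unfold_locales (rule x(1))
  have G: "G = cut.G" using assms(1) Y(2) by (simp add: cut.G_def)
  obtain \<sigma>0 where \<sigma>0: "is_switching G \<sigma>0" using typed_forest_has_switching[OF assms(2)] .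
  have "dual_wire x \<notin># Y" using cut.dual_wire_notin_Y assms(3) \<sigma>0 G by simp
  moreover have "dual_wire x \<in># forest_wires G" using closed[of x] by (simp add: wires_G)
  ultimately have y: "dual_wire x \<in># forest_wires F" by (simp add: wires_G)
  interpret atomic_cut_reduction F x Y A B
  proof unfold_locales
    fix z
    show "count (forest_wires F) z \<le> 1" "count Y z \<le> 1"
      using linear_G[of z] by (simp_all add: wires_G split: if_splits)
    show "z \<notin># forest_wires F" if "z \<in># Y"
    proof
      assume "z \<in># forest_wires F"
      with that have "count Y z > 0" "count (forest_wires F) z > 0" by simp_all
      moreover have "count Y z + count (forest_wires F) z \<le> 1"
        using linear_G[of z] by (simp add: wires_G split: if_splits)
      ultimately show False by linarith
    qed
  qed (use y Y in auto)
  have AC: "AC (subst_forest (dual_wire x) t F)"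
    using AC_subst_forest assms(3) \<sigma>0 G Y(2) by simp
  have "forest_wires F' = forest_wires F - {#dual_wire x#} + Y"
  proof -
    have "count (forest_wires F) (dual_wire x) = 1"
      using y linear[of "dual_wire x"] by (simp add: le_antisym Suc_leI)
    moreover have "forest_wires F' =
      (\<Sum>z\<in>#forest_wires F. if z = dual_wire x then Y else {#z#})"
      unfolding forest_wires_root_nodes root_nodes_subst_forest sum_mset_sum_mset
      by (simp add: multiset.map_comp o_def node_wires_subst_node cong: if_cong)
    ultimately show ?thesis using sum_mset_replace_once by metis
  qed
  then have count_F': "count (forest_wires F') z =
      (if z = x \<or> z = dual_wire x then 0 else count (forest_wires G) z)" for z
    using x y linear_G[of z] \<open>dual_wire x \<notin># Y\<close> by (auto simp: wires_G not_in_iff)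
  (* The reduction removes x and its dual, and keeps every other wire variable of G. *)
  have in_F': "z \<in># forest_wires F' \<longleftrightarrow> z \<noteq> x \<and> z \<noteq> dual_wire x \<and> z \<in># forest_wires G" for z
    unfolding count_greater_zero_iff[symmetric] count_F' by auto
  have "typed_root \<tau> r" if r: "r \<in># F'" for r
  proof -
    obtain r0 where "r0 \<in># F" "r = subst_root (dual_wire x) (Exp (image_mset Wire Y)) r0"
      using r by (auto simp: subst_forest_def)
    moreover have "\<forall>w\<in>#image_mset Wire Y. has_wit_type \<tau> w (wire_type \<tau> (dual_wire x))"
      using Y(3) has_type_has_wit_type.wire by (metis (mono_tags, lifting) imageE set_image_mset)
    ultimately show ?thesis
      using typed assms(1) Y(1) typed_root_subst_root
      by (metis image_mset_is_empty_iff insert_iff set_mset_add_mset_insert)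
  qed
  moreover have "count (forest_wires F') z \<le> 1" for z
    using count_F' linear_G by simp
  moreover have "z \<in># forest_wires F' \<longleftrightarrow> dual_wire z \<in># forest_wires F'" for z
    using in_F'[of z] in_F'[of "dual_wire z"] closed[of z] by (metis dual_wire_dual_wire)
  ultimately have "typed_forest \<tau> (subst_forest (dual_wire x) t F)"
    unfolding typed_forest_def Y(2) by blast
  moreover have "forest_type G = forest_type F" by (simp add: forest_type_def assms(1))
  ultimately show ?thesis using AC is_closure_subst_forest by metis
qed

end
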